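(* Let $Q$ be a quiver and $\underline d,\underline f,\underline k\in\mathbb{Z}_{\ge0}^{Q_0}$ with $k_v\le d_v$ for all $v$. Suppose $\underline k\ne0$. The space $\mathcal{M}_Q(\underline d,\underline d-\underline k;\underline f)$ is nonempty if and only if $$\mathcal{M}_Q\left(\underline d-\underline k,\ \underline d-\underline k-\max(\underline k+\underline k^0[\underline d-\underline k],0);\ \underline f\right)$$ is nonempty.
   Context: Everything is over $\mathbb{C}$. $Q=(Q_0,Q_1,\mathrm{out},\mathrm{in})$ is a quiver (loops and multiple arrows allowed); an arrow $e\in Q_1$ goes from $\mathrm{out}(e)$ to $\mathrm{in}(e)$; $Q_1(v,w)$ is the set of arrows from $v$ to $w$. For a dimension vector $\underline c$ (with the fixed framing $\underline f$), $\underline k^0[\underline c]\in\mathbb{Z}^{Q_0}$ has components $k_v^0[\underline c]=2c_v-\sum_w(|Q_1(v,w)|+|Q_1(w,v)|)c_w-f_v$. The maximum of two vectors is taken componentwise. Given $\underline{d},\underline{f}\in\mathbb{Z}_{\ge0}^{Q_0}$, fix vector spaces $D_v,F_v$ with $\dim D_v=d_v$, $\dim F_v=f_v$. A representation of the double framed quiver with dimension vector $\underline d$ and framing vector $\underline f$ is a tuple $(A_e,B_e,i_v,j_v)$ with $A_e:D_{\mathrm{out}(e)}\to D_{\mathrm{in}(e)}$, $B_e:D_{\mathrm{in}(e)}\to D_{\mathrm{out}(e)}$, $i_v:F_v\to D_v$, $j_v:D_v\to F_v$ linear. Moment map equations: for all $v$, $\sum_{\mathrm{in}(e)=v}A_eB_e-\sum_{\mathrm{out}(e)=v}B_eA_e+i_vj_v=0$.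 Stability: the only collection of subspaces $D'_v\subseteq D_v$ with $i_v(F_v)\subseteq D'_v$ for all $v$ and preserved by all $A_e,B_e$ is $D'_v=D_v$. The group $G_{\underline d}=\prod_v\mathrm{GL}(D_v)$ acts by $g\cdot(A,B,i,j)=(g_{\mathrm{in}(e)}A_eg_{\mathrm{out}(e)}^{-1},g_{\mathrm{out}(e)}B_eg_{\mathrm{in}(e)}^{-1},g_vi_v,j_vg_v^{-1})$. The split parabolic quiver variety $\mathcal{M}_Q(\underline d^{(0)},\underline d^{(1)};\underline f)$ parametrizes triples $(D^{(0)},D^{(1)},\pi)$ where $D^{(0)},D^{(1)}$ are stable representations satisfying the moment map equations, of dimension vectors $\underline d^{(0)},\underline d^{(1)}$ and common framing spaces $F_v$, and $\pi=(\pi_v:D^{(0)}_v\to D^{(1)}_v)_v$ are linear maps intertwining the $A_e$'s and $B_e$'s, with $\pi_vi^{(0)}_v=i^{(1)}_v$, $j_v^{(1)}\pi_v=j_v^{(0)}$ (stability forces $\pi_v$ surjective), such that all $A_e^{(0)},B_e^{(0)},j_v^{(0)}$ vanish on $\ker\pi$; precisely, it is the quotient of the variety of such triples by the free action of $G_{\underline d^{(0)}}\times G_{\underline d^{(1)}}$. If $\underline d^{(1)}$ has a negative entry, the variety is understood to be empty. *)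

theory Defs
  imports
    "Graph_Theory.Digraph"
    "Jordan_Normal_Form.Matrix_Kernel"
    "HOL-Algebra.Group_Action"
    "HOL-Algebra.Product_Groups"
begin

text \<open>
  A quiver is a finite directed multigraph (\<^locale>\<open>fin_digraph\<close>) with out = \<^const>\<open>tail\<close>
  and in = \<^const>\<open>head\<close>. The fixed vector spaces are the standard ones: D_v is the space of complex
  column vectors of dimension d v, so linear maps are matrices; d v = 0 is allowed.
  Families indexed by vertices or arrows are extensional, so that they carry no
  information outside the quiver.
\<close>

definition arrows_between :: "('v, 'e) pre_digraph \<Rightarrow> 'v \<Rightarrow> 'v \<Rightarrow> 'e set" where
  "arrows_between Q v w = {e \<in> arcs Q. tail Q e = v \<and> head Q e = w}"

definition k0 :: "('v, 'e) pre_digraph \<Rightarrow> ('v \<Rightarrow> nat) \<Rightarrow> ('v \<Rightarrow> int) \<Rightarrow> 'v \<Rightarrow> int" where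
  "k0 Q f c v =
     2 * c v
     - (\<Sum>w\<in>verts Q. int (card (arrows_between Q v w) + card (arrows_between Q w v)) * c w)
     - int (f v)"

record ('v, 'e) framed_rep =
  mapA :: "'e \<Rightarrow> complex mat"
  mapB :: "'e \<Rightarrow> complex mat"
  mapI :: "'v \<Rightarrow> complex mat"
  mapJ :: "'v \<Rightarrow> complex mat"

definition framed_reps ::
  "('v, 'e) pre_digraph \<Rightarrow> ('v \<Rightarrow> nat) \<Rightarrow> ('v \<Rightarrow> nat) \<Rightarrow> ('v, 'e) framed_rep set" where
  "framed_reps Q d f =
     {R. mapA R \<in> (\<Pi>\<^sub>E e\<in>arcs Q. carrier_mat (d (head Q e)) (d (tail Q e))) \<and>
         mapB R \<in> (\<Pi>\<^sub>E e\<in>arcs Q. carrier_mat (d (tail Q e)) (d (head Q e))) \<and>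
         mapI R \<in> (\<Pi>\<^sub>E v\<in>verts Q. carrier_mat (d v) (f v)) \<and>
         mapJ R \<in> (\<Pi>\<^sub>E v\<in>verts Q. carrier_mat (f v) (d v))}"

definition moment_map_eqs ::
  "('v, 'e) pre_digraph \<Rightarrow> ('v \<Rightarrow> nat) \<Rightarrow> ('v, 'e) framed_rep \<Rightarrow> bool" where
  "moment_map_eqs Q d R \<longleftrightarrow>
     (\<forall>v\<in>verts Q.
        finsum (ring_mat TYPE(complex) (d v) ()) (\<lambda>e. mapA R e * mapB R e)
          {e \<in> arcs Q. head Q e = v}
        - finsum (ring_mat TYPE(complex) (d v) ()) (\<lambda>e. mapB R e * mapA R e)
          {e \<in> arcs Q. tail Q e = v}
        + mapI R v * mapJ R v
        = 0\<^sub>m (d v) (d v))"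

definition stable ::
  "('v, 'e) pre_digraph \<Rightarrow> ('v \<Rightarrow> nat) \<Rightarrow> ('v \<Rightarrow> nat) \<Rightarrow> ('v, 'e) framed_rep \<Rightarrow> bool" where
  "stable Q d f R \<longleftrightarrow>
     (\<forall>W :: 'v \<Rightarrow> complex vec set.
        (\<forall>v\<in>verts Q. VectorSpace.subspace class_ring (W v) (module_vec TYPE(complex) (d v))) \<and>
        (\<forall>v\<in>verts Q. \<forall>x\<in>carrier_vec (f v). mapI R v *\<^sub>v x \<in> W v) \<and>
        (\<forall>e\<in>arcs Q. \<forall>x\<in>W (tail Q e). mapA R e *\<^sub>v x \<in> W (head Q e)) \<and>
        (\<forall>e\<in>arcs Q. \<forall>x\<in>W (head Q e). mapB R e *\<^sub>v x \<in> W (tail Q e))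
        \<longrightarrow> (\<forall>v\<in>verts Q. W v = carrier_vec (d v)))"

definition GL :: "nat \<Rightarrow> complex mat monoid" where
  "GL n = units_of (ring_mat TYPE(complex) n ())"

definition gauge_group ::
  "('v, 'e) pre_digraph \<Rightarrow> ('v \<Rightarrow> nat) \<Rightarrow> ('v \<Rightarrow> complex mat) monoid" where
  "gauge_group Q d = product_group (verts Q) (\<lambda>v. GL (d v))"

definition rep_action ::
  "('v, 'e) pre_digraph \<Rightarrow> ('v \<Rightarrow> nat) \<Rightarrow> ('v \<Rightarrow> complex mat) \<Rightarrow>
   ('v, 'e) framed_rep \<Rightarrow> ('v, 'e) framed_rep" where
  "rep_action Q d g R =
     (let h = (\<lambda>v. inv\<^bsub>GL (d v)\<^esub> (g v)) in
      \<lparr> mapA = (\<lambda>e\<in>arcs Q. g (head Q e) * mapA R e * h (tail Q e)),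
        mapB = (\<lambda>e\<in>arcs Q. g (tail Q e) * mapB R e * h (head Q e)),
        mapI = (\<lambda>v\<in>verts Q. g v * mapI R v),
        mapJ = (\<lambda>v\<in>verts Q. mapJ R v * h v) \<rparr>)"

type_synonym ('v, 'e) rep_triple =
  "('v, 'e) framed_rep \<times> ('v, 'e) framed_rep \<times> ('v \<Rightarrow> complex mat)"

definition split_parabolic_triples ::
  "('v, 'e) pre_digraph \<Rightarrow> ('v \<Rightarrow> nat) \<Rightarrow> ('v \<Rightarrow> nat) \<Rightarrow> ('v \<Rightarrow> nat) \<Rightarrow>
   ('v, 'e) rep_triple set" where
  "split_parabolic_triples Q d0 d1 f =
     {(R0, R1, \<pi>).
        R0 \<in> framed_reps Q d0 f \<and> moment_map_eqs Q d0 R0 \<and> stable Q d0 f R0 \<and>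
        R1 \<in> framed_reps Q d1 f \<and> moment_map_eqs Q d1 R1 \<and> stable Q d1 f R1 \<and>
        \<pi> \<in> (\<Pi>\<^sub>E v\<in>verts Q. carrier_mat (d1 v) (d0 v)) \<and>
        (\<forall>e\<in>arcs Q. \<pi> (head Q e) * mapA R0 e = mapA R1 e * \<pi> (tail Q e)) \<and>
        (\<forall>e\<in>arcs Q. \<pi> (tail Q e) * mapB R0 e = mapB R1 e * \<pi> (head Q e)) \<and>
        (\<forall>v\<in>verts Q. \<pi> v * mapI R0 v = mapI R1 v) \<and>
        (\<forall>v\<in>verts Q. mapJ R1 v * \<pi> v = mapJ R0 v) \<and>
        (\<forall>e\<in>arcs Q. \<forall>x\<in>mat_kernel (\<pi> (tail Q e)). mapA R0 e *\<^sub>v x = 0\<^sub>v (d0 (head Q e))) \<and>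
        (\<forall>e\<in>arcs Q. \<forall>x\<in>mat_kernel (\<pi> (head Q e)). mapB R0 e *\<^sub>v x = 0\<^sub>v (d0 (tail Q e))) \<and>
        (\<forall>v\<in>verts Q. \<forall>x\<in>mat_kernel (\<pi> v). mapJ R0 v *\<^sub>v x = 0\<^sub>v (f v))}"

definition triple_action ::
  "('v, 'e) pre_digraph \<Rightarrow> ('v \<Rightarrow> nat) \<Rightarrow> ('v \<Rightarrow> nat) \<Rightarrow>
   ('v \<Rightarrow> complex mat) \<times> ('v \<Rightarrow> complex mat) \<Rightarrow> ('v, 'e) rep_triple \<Rightarrow> ('v, 'e) rep_triple" where
  "triple_action Q d0 d1 =
     (\<lambda>(g0, g1) (R0, R1, \<pi>).
        (rep_action Q d0 g0 R0, rep_action Q d1 g1 R1,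
         \<lambda>v\<in>verts Q. g1 v * \<pi> v * inv\<^bsub>GL (d0 v)\<^esub> (g0 v)))"

text \<open>
  The variety as the set of its points, i.e. of orbits. Dimension vectors are integer-valued, and
  the variety is empty as soon as one of them has a negative entry.
\<close>

definition split_parabolic_quiver_variety ::
  "('v, 'e) pre_digraph \<Rightarrow> ('v \<Rightarrow> int) \<Rightarrow> ('v \<Rightarrow> int) \<Rightarrow> ('v \<Rightarrow> nat) \<Rightarrow>
   ('v, 'e) rep_triple set set" where
  "split_parabolic_quiver_variety Q d0 d1 f =
     (if \<forall>v\<in>verts Q. 0 \<le> d0 v \<and> 0 \<le> d1 v then
        (let n0 = (\<lambda>v. nat (d0 v)); n1 = (\<lambda>v. nat (d1 v)) in
         orbits (gauge_group Q n0 \<times>\<times> gauge_group Q n1)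
           (split_parabolic_triples Q n0 n1 f) (triple_action Q n0 n1))
      else {})"

end

theory Submission
  imports Defs
begin

text \<open>
  Put \<open>c = d - k\<close>. To a stable representation \<open>R\<close> of dimension \<open>c\<close> that satisfies the moment map
  equations and to a vertex \<open>v\<close> belongs a complex \<open>D v \<rightarrow> M v \<rightarrow> D v\<close>, where
  \<open>M v\<close> is the sum of the framing space and of the spaces at the other ends of the arrows at \<open>v\<close>; write
  \<open>N v\<close> for the dimension of \<open>M v\<close>. The first map \<open>\<alpha> v\<close> collects all maps that leave
  \<open>v\<close>, the second map \<open>\<beta> v\<close> all maps that enter \<open>v\<close>. The moment map equation says
  \<open>\<beta> v * \<alpha> v = 0\<close>, stability makes \<open>\<beta> v\<close> surjective, and \<open>k0 c v = 2 * c v - N v\<close>.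
  Both nonemptiness statements are conditions on the ranks of the maps \<open>\<alpha> v\<close>.

  A split lift of \<open>R\<close> to dimension \<open>d\<close> amounts to an extension of every \<open>\<beta> v\<close> to a surjection
  from \<open>M v\<close> onto a space of dimension \<open>d v\<close> that still annihilates \<open>\<alpha> v\<close>: on the kernel of
  the projection all maps vanish, so the lift only adds to the targets of the maps that enter \<open>v\<close>, and its moment map equation
  and stability are exactly these two properties. Such an extension exists if and only if \<open>rank (\<alpha> v) + d v \<le> N v\<close>.
  This is the content of \<open>split_lift_rank_bound\<close> and \<open>split_lift_exists\<close>.

  A split quotient of \<open>R\<close> of dimension \<open>b\<close> amounts to a choice of subspaces of dimension \<open>c v - b v\<close>
  in the kernels of the \<open>\<alpha> v\<close>: such subspaces are annihilated by all maps that leave \<open>v\<close>, and the quotient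
  by them satisfies the moment map equations and is stable. They exist if and only if \<open>rank (\<alpha> v) \<le> b v \<le> c v\<close>.
  This is the content of \<open>split_quotient_rank_bound\<close> and \<open>split_quotient_exists\<close>.

  For \<open>b = c - max (k + k0 c) 0 = min c (N - d)\<close> the two conditions agree, because \<open>\<alpha> v\<close> has rank at most
  \<open>c v\<close> in any case. So a stable \<open>R\<close> of dimension \<open>c\<close> has a split lift of dimension \<open>d\<close>
  if and only if it has a split quotient of dimension \<open>b\<close>.

  Ranks are handled through factorizations and one-sided inverses of matrices: Gauss--Jordan elimination provides full-rank factorizations,
  and the trace of an idempotent provides the dimension counts.
\<close>

section \<open>Rank bounds by factorization\<close>

text \<open>
  Row reduction writes \<open>A\<close> as an invertible matrix times a reduced echelon matrix. The \<open>r\<close> nonzero rows of the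
  latter form \<open>V\<close>, and the corresponding columns of the former form \<open>U\<close>; the pivot columns give the right inverse
  of \<open>V\<close>.
\<close>

lemma full_rank_factorization:
  fixes A :: "'a::field mat"
  assumes A: "A \<in> carrier_mat n m"
  obtains r U V U' V' where
    "U \<in> carrier_mat n r" "V \<in> carrier_mat r m" "A = U * V"
    "U' \<in> carrier_mat r n" "U' * U = 1\<^sub>m r"
    "V' \<in> carrier_mat m r" "V * V' = 1\<^sub>m r"
proof -
  define C where "C = gauss_jordan_single A"
  note gj = gauss_jordan_single[OF A C_def[symmetric]]
  have C: "C \<in> carrier_mat n m" by (rule gj(2))
  obtain P Q where P: "P \<in> carrier_mat n n" and Q: "Q \<in> carrier_mat n n"
    and CP: "C = P * A" and PQ: "P * Q = 1\<^sub>m n" and QP: "Q * P = 1\<^sub>m n"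
    using gj(4) by blast
  have AQ: "A = Q * C"
    using assoc_mult_mat[OF Q P A] A by (simp add: CP QP)
  obtain f where f: "pivot_fun C f m"
    using gj(3) C by (auto simp: row_echelon_form_def)
  note piv = pivot_funD[OF carrier_matD(1)[OF C] f]
  \<comment> \<open>A row of \<open>C\<close> without pivot is zero, and so are all later rows.\<close>
  define r where "r = (LEAST i. i = n \<or> f i = m)"
  have r: "r = n \<or> f r = m" and "r \<le> n"
    unfolding r_def by (rule LeastI2[of _ n]; simp) (rule Least_le; simp)
  have lt: "f i < m" if "i < r" for i
    using that not_less_Least[of i "\<lambda>i. i = n \<or> f i = m"] piv(1)[of i] \<open>r \<le> n\<close>
    unfolding r_def by force
  have ge: "f i = m" if "r \<le> i" "i < n" for i
    using that
  proof (induction i rule: dec_induct)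
    case base then show ?case using r by auto
  next
    case (step i)
    then have "f i = m" by simp
    then show ?case using piv(3)[of i] piv(1)[of "Suc i"] step.prems by force
  qed
  have zero: "C $$ (i, j) = 0" if "r \<le> i" "i < n" "j < m" for i j
    using piv(2)[of i j] ge[of i] that by simp
  define U where "U = mat n r (\<lambda>(i, j). Q $$ (i, j))"
  define V where "V = mat r m (\<lambda>(i, j). C $$ (i, j))"
  define U' where "U' = mat r n (\<lambda>(i, j). P $$ (i, j))"
  define V' where "V' = mat m r (\<lambda>(i, j). if i = f j then 1 else 0 :: 'a)"
  have "A = U * V"
  proof (rule eq_matI)
    show "dim_row A = dim_row (U * V)" "dim_col A = dim_col (U * V)"
      using A by (auto simp: U_def V_def)
    fix i j assume "i < dim_row (U * V)" "j < dim_col (U * V)"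
    then have ij: "i < n" "j < m" by (auto simp: U_def V_def)
    have "A $$ (i, j) = (\<Sum>l<n. Q $$ (i, l) * C $$ (l, j))"
      using ij Q C by (simp add: AQ scalar_prod_def lessThan_atLeast0)
    also have "\<dots> = (\<Sum>l<r. Q $$ (i, l) * C $$ (l, j))"
      using \<open>r \<le> n\<close> ij zero by (intro sum.mono_neutral_right) auto
    also have "\<dots> = (U * V) $$ (i, j)"
      using ij by (simp add: U_def V_def scalar_prod_def lessThan_atLeast0)
    finally show "A $$ (i, j) = (U * V) $$ (i, j)" .
  qed
  moreover have "U' * U = 1\<^sub>m r"
  proof (rule eq_matI)
    fix i j assume "i < dim_row (1\<^sub>m r :: 'a mat)" "j < dim_col (1\<^sub>m r :: 'a mat)"
    then have ij: "i < r" "j < r" by auto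
    have "(U' * U) $$ (i, j) = (P * Q) $$ (i, j)"
      using ij P Q \<open>r \<le> n\<close> by (simp add: U_def U'_def scalar_prod_def)
    then show "(U' * U) $$ (i, j) = 1\<^sub>m r $$ (i, j)" using ij \<open>r \<le> n\<close> PQ by simp
  qed (auto simp: U_def U'_def)
  moreover have "V * V' = 1\<^sub>m r"
  proof (rule eq_matI)
    fix i j assume "i < dim_row (1\<^sub>m r :: 'a mat)" "j < dim_col (1\<^sub>m r :: 'a mat)"
    then have ij: "i < r" "j < r" by auto
    have "(V * V') $$ (i, j) = (\<Sum>l<m. C $$ (i, l) * (if l = f j then 1 else 0))"
      using ij by (simp add: V_def V'_def scalar_prod_def lessThan_atLeast0)
    also have "\<dots> = C $$ (i, f j)"
      using lt[OF ij(2)] by (simp add: if_distrib cong: if_cong)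
    also have "\<dots> = 1\<^sub>m r $$ (i, j)"
      using ij lt[of j] \<open>r \<le> n\<close> piv(4)[of j] piv(5)[of j i] by (cases "i = j") auto
    finally show "(V * V') $$ (i, j) = 1\<^sub>m r $$ (i, j)" .
  qed (auto simp: V_def V'_def)
  moreover have "U \<in> carrier_mat n r" "V \<in> carrier_mat r m" "U' \<in> carrier_mat r n" "V' \<in> carrier_mat m r"
    by (auto simp: U_def V_def U'_def V'_def)
  ultimately show thesis using that by blast
qed

lemma trace_mult_commute:
  fixes A B :: "'a::comm_semiring_0 mat"
  assumes "A \<in> carrier_mat n m" "B \<in> carrier_mat m n"
  shows "(\<Sum>i<n. (A * B) $$ (i, i)) = (\<Sum>j<m. (B * A) $$ (j, j))"
proof -
  have "(\<Sum>i<n. (A * B) $$ (i, i)) = (\<Sum>i<n. \<Sum>j<m. A $$ (i, j) * B $$ (j, i))"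
    using assms by (simp add: scalar_prod_def lessThan_atLeast0)
  also have "\<dots> = (\<Sum>j<m. \<Sum>i<n. B $$ (j, i) * A $$ (i, j))"
    by (subst sum.swap) (simp add: mult.commute)
  also have "\<dots> = (\<Sum>j<m. (B * A) $$ (j, j))"
    using assms by (simp add: scalar_prod_def lessThan_atLeast0)
  finally show ?thesis .
qed

lemma cancel_right_inverse:
  fixes X Y Z W :: "'a::semiring_1 mat"
  assumes "X \<in> carrier_mat n r" "Y \<in> carrier_mat n r"
    and "Z \<in> carrier_mat r m" "W \<in> carrier_mat m r" "Z * W = 1\<^sub>m r" "X * Z = Y * Z"
  shows "X = Y"
proof -
  have "X * (Z * W) = (X * Z) * W" using assms by (intro assoc_mult_mat[symmetric])
  also have "X * Z = Y * Z" by fact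
  also have "Y * Z * W = Y * (Z * W)" using assms by (intro assoc_mult_mat)
  finally show ?thesis using assms by simp
qed

lemma cancel_left_inverse:
  fixes X Y Z W :: "'a::semiring_1 mat"
  assumes "X \<in> carrier_mat r n" "Y \<in> carrier_mat r n"
    and "Z \<in> carrier_mat m r" "W \<in> carrier_mat r m" "W * Z = 1\<^sub>m r" "Z * X = Z * Y"
  shows "X = Y"
proof -
  have "(W * Z) * X = W * (Z * X)" using assms by (intro assoc_mult_mat)
  also have "Z * X = Z * Y" by fact
  also have "W * (Z * Y) = (W * Z) * Y" using assms by (intro assoc_mult_mat[symmetric])
  finally show ?thesis using assms by simp
qed

text \<open>
  Here \<open>Y * X\<close> is the projection onto the image of \<open>Y\<close> along the kernel of \<open>X\<close>, and
  \<open>U * V\<close> is a full-rank factorization of the complementary projection. The two ranks add up to \<open>N\<close> because the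
  trace of an idempotent is its rank; this is where characteristic zero enters. This lemma supplies every dimension count below.
\<close>

lemma complementary_factorization:
  fixes X Y :: "'a::field_char_0 mat"
  assumes X: "X \<in> carrier_mat a N" and Y: "Y \<in> carrier_mat N a" and XY: "X * Y = 1\<^sub>m a"
  obtains V U where
    "a \<le> N" "V \<in> carrier_mat (N - a) N" "U \<in> carrier_mat N (N - a)"
    "V * U = 1\<^sub>m (N - a)" "X * U = 0\<^sub>m a (N - a)" "V * Y = 0\<^sub>m (N - a) a"
    "Y * X + U * V = 1\<^sub>m N"
proof -
  define E where "E = 1\<^sub>m N - Y * X"
  have E: "E \<in> carrier_mat N N" using X Y by (auto simp: E_def)
  have YX: "Y * X \<in> carrier_mat N N" using X Y by auto
  obtain s U V U' V' where
    U: "U \<in> carrier_mat N s" and V: "V \<in> carrier_mat s N" and EUV: "E = U * V"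
    and U': "U' \<in> carrier_mat s N" and UU: "U' * U = 1\<^sub>m s"
    and V': "V' \<in> carrier_mat N s" and VV: "V * V' = 1\<^sub>m s"
    by (rule full_rank_factorization[OF E])
  have XE: "X * E = 0\<^sub>m a N"
  proof -
    have "X * E = X * 1\<^sub>m N - X * (Y * X)"
      unfolding E_def using mult_minus_distrib_mat[OF X _ YX, of "1\<^sub>m N"] by simp
    also have "X * (Y * X) = X" using assoc_mult_mat[OF X Y X] X by (simp add: XY)
    finally show ?thesis using X by simp
  qed
  have EY: "E * Y = 0\<^sub>m N a"
  proof -
    have "E * Y = 1\<^sub>m N * Y - Y * X * Y"
      unfolding E_def using minus_mult_distrib_mat[OF _ YX Y, of "1\<^sub>m N"] by simp
    also have "Y * X * Y = Y" using assoc_mult_mat[OF Y X Y] Y by (simp add: XY)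
    finally show ?thesis using Y by simp
  qed
  have EE: "E * E = E"
  proof -
    have "E * E = E * 1\<^sub>m N - E * (Y * X)"
      by (subst (2) E_def) (use mult_minus_distrib_mat[OF E _ YX, of "1\<^sub>m N"] in simp)
    also have "E * (Y * X) = 0\<^sub>m N N" using assoc_mult_mat[OF E Y X] X by (simp add: EY)
    also have "E * 1\<^sub>m N - 0\<^sub>m N N = E" using E by (intro eq_matI) auto
    finally show ?thesis .
  qed
  have XU: "X * U = 0\<^sub>m a s"
    by (rule cancel_right_inverse[OF _ _ V V' VV])
      (use X U V XE assoc_mult_mat[OF X U V] in \<open>auto simp: EUV\<close>)
  have VY: "V * Y = 0\<^sub>m s a"
    by (rule cancel_left_inverse[OF _ _ U U' UU])
      (use Y U V EY assoc_mult_mat[OF U V Y] in \<open>auto simp: EUV\<close>)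
  have VU: "V * U = 1\<^sub>m s"
  proof (rule cancel_right_inverse[OF _ _ V V' VV])
    show "V * U * V = 1\<^sub>m s * V"
    proof (rule cancel_left_inverse[OF _ _ U U' UU])
      have "U * (V * U * V) = (U * V) * (U * V)"
        using U V assoc_mult_mat[of U N s "V * U" s V N] assoc_mult_mat[of U N s V N U s]
          assoc_mult_mat[of "U * V" N N U s V N] by simp
      also have "\<dots> = U * V" using EE by (simp add: EUV)
      finally show "U * (V * U * V) = U * (1\<^sub>m s * V)" using V by simp
    qed (use U V in auto)
  qed (use U V in auto)
  \<comment> \<open>The trace of an idempotent is its rank, here computed from both sides.\<close>
  have "of_nat N - of_nat a = (of_nat s :: 'a)"
  proof -
    have "of_nat s = (\<Sum>i<s. (V * U) $$ (i, i))" by (simp add: VU)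
    also have "\<dots> = (\<Sum>i<N. E $$ (i, i))"
      unfolding EUV by (rule trace_mult_commute[OF V U])
    also have "\<dots> = (\<Sum>i<N. 1 - (Y * X) $$ (i, i))"
      using X Y by (intro sum.cong) (auto simp: E_def)
    also have "\<dots> = of_nat N - (\<Sum>i<N. (Y * X) $$ (i, i))"
      by (simp add: sum_subtractf)
    also have "(\<Sum>i<N. (Y * X) $$ (i, i)) = of_nat a"
      by (subst trace_mult_commute[OF Y X]) (simp add: XY)
    finally show ?thesis by simp
  qed
  then have "(of_nat N :: 'a) = of_nat (s + a)" by (simp add: algebra_simps)
  then have N: "N = s + a" by (simp only: of_nat_eq_iff)
  have "Y * X + U * V = 1\<^sub>m N"
    unfolding EUV[symmetric] E_def using X Y by (intro eq_matI) auto
  with that[of V U] show thesis using U V VU XU VY by (simp add: N)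
qed

text \<open>
  The rank bound in the form in which it is produced and consumed: a factorization of width \<open>r\<close>.
\<close>

definition rank_le :: "nat \<Rightarrow> 'a::semiring_0 mat \<Rightarrow> bool" where
  "rank_le r A \<longleftrightarrow>
     (\<exists>U \<in> carrier_mat (dim_row A) r. \<exists>V \<in> carrier_mat r (dim_col A). A = U * V)"

lemma rank_le_ncols:
  fixes A :: "'a::semiring_1 mat"
  assumes "A \<in> carrier_mat n m" shows "rank_le m A"
  unfolding rank_le_def using assms by (intro bexI[of _ A] bexI[of _ "1\<^sub>m m"]) auto

lemma rank_le_mono:
  fixes A :: "'a::semiring_1 mat"
  assumes "rank_le r A" "r \<le> s" shows "rank_le s A"
proof -
  obtain U V where U: "U \<in> carrier_mat (dim_row A) r" and V: "V \<in> carrier_mat r (dim_col A)"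
    and A: "A = U * V"
    using assms(1) by (auto simp: rank_le_def)
  define U' where "U' = mat (dim_row A) s (\<lambda>(i, j). if j < r then U $$ (i, j) else 0)"
  define V' where "V' = mat s (dim_col A) (\<lambda>(i, j). if i < r then V $$ (i, j) else 0)"
  have "U' * V' = U * V"
  proof (rule eq_matI)
    fix i j assume "i < dim_row (U * V)" "j < dim_col (U * V)"
    then have ij: "i < dim_row A" "j < dim_col A" by (simp_all add: A)
    have "(U' * V') $$ (i, j) = (\<Sum>l<s. if l < r then U $$ (i, l) * V $$ (l, j) else 0)"
      using ij by (auto simp: U'_def V'_def scalar_prod_def lessThan_atLeast0 intro!: sum.cong)
    also have "\<dots> = (\<Sum>l<r. U $$ (i, l) * V $$ (l, j))"
      using \<open>r \<le> s\<close> by (intro sum.mono_neutral_cong_right) auto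
    also have "\<dots> = (U * V) $$ (i, j)"
      using ij U V by (simp add: scalar_prod_def lessThan_atLeast0)
    finally show "(U' * V') $$ (i, j) = (U * V) $$ (i, j)" .
  qed (use U V in \<open>simp_all add: U'_def V'_def\<close>)
  then show ?thesis
    unfolding rank_le_def by (intro bexI[of _ U'] bexI[of _ V']) (simp_all add: A[symmetric] U'_def V'_def)
qed

text \<open>
  The image of \<open>A\<close> lies in the kernel of the surjection \<open>G\<close>, which has dimension \<open>N - d\<close>.
\<close>

lemma left_annihilator_imp_rank_le:
  fixes G :: "'a::field_char_0 mat"
  assumes G: "G \<in> carrier_mat d N" and G': "G' \<in> carrier_mat N d" and GG: "G * G' = 1\<^sub>m d"
    and A: "A \<in> carrier_mat N c" and GA: "G * A = 0\<^sub>m d c"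
  shows "d \<le> N" "rank_le (N - d) A"
proof -
  obtain V U where dN: "d \<le> N" and V: "V \<in> carrier_mat (N - d) N" and U: "U \<in> carrier_mat N (N - d)"
    and one: "G' * G + U * V = 1\<^sub>m N"
    by (rule complementary_factorization[OF G G' GG]) blast
  show "d \<le> N" by fact
  have "A = (G' * G + U * V) * A" using A by (simp add: one)
  also have "\<dots> = G' * (G * A) + U * (V * A)"
    using add_mult_distrib_mat[of "G' * G" N N "U * V" A c] assoc_mult_mat[OF G' G A]
      assoc_mult_mat[OF U V A] G G' U V A by simp
  also have "\<dots> = U * (V * A)" using G' U V A by (simp add: GA)
  finally have "A = U * (V * A)" .
  moreover have "V * A \<in> carrier_mat (N - d) c" using V A by auto
  ultimately show "rank_le (N - d) A"
    unfolding rank_le_def using A U by auto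
qed

lemma factorization_width_le:
  fixes U V U' V' :: "'a::field_char_0 mat"
  assumes U: "U \<in> carrier_mat n r" and V: "V \<in> carrier_mat r m"
    and U': "U' \<in> carrier_mat r n" and UU: "U' * U = 1\<^sub>m r"
    and V': "V' \<in> carrier_mat m r" and VV: "V * V' = 1\<^sub>m r"
    and rank: "rank_le s (U * V)"
  shows "r \<le> s"
proof -
  obtain S T where S: "S \<in> carrier_mat n s" and T: "T \<in> carrier_mat s m" and UV: "U * V = S * T"
    using rank U V by (auto simp: rank_le_def)
  have "(U' * S) * (T * V') = U' * (S * T) * V'"
    using U' S T V' assoc_mult_mat[of U' r n S s "T * V'" r] assoc_mult_mat[of S n s T m V' r]
      assoc_mult_mat[of U' r n "S * T" m V' r] by simp
  also have "\<dots> = (U' * U) * (V * V')"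
    using U U' V V' assoc_mult_mat[of U' r n "U * V" m V' r] assoc_mult_mat[of U n r V m V' r]
      assoc_mult_mat[of U' r n U r "V * V'" r] by (simp add: UV[symmetric])
  also have "\<dots> = 1\<^sub>m r" by (simp add: UU VV)
  finally have "(U' * S) * (T * V') = 1\<^sub>m r" .
  from complementary_factorization[OF _ _ this, of s] show ?thesis
    using U' S T V' by auto
qed

text \<open>
  A full-rank factorization has width \<open>r \<le> s\<close>. Its surjective factor \<open>V\<close> is completed to a surjection onto
  \<open>s\<close> dimensions by rows of a complement, and the left factor ignores these rows.
\<close>

lemma rank_le_imp_factors_through_surjection:
  fixes A :: "'a::field_char_0 mat"
  assumes A: "A \<in> carrier_mat n c" and rank: "rank_le s A" and "s \<le> c"
  obtains S P P' where "P \<in> carrier_mat s c" "P' \<in> carrier_mat c s" "P * P' = 1\<^sub>m s"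
    "S \<in> carrier_mat n s" "A = S * P"
proof -
  obtain r U V U' V' where
    U: "U \<in> carrier_mat n r" and V: "V \<in> carrier_mat r c" and AUV: "A = U * V"
    and U': "U' \<in> carrier_mat r n" and UU: "U' * U = 1\<^sub>m r"
    and V': "V' \<in> carrier_mat c r" and VV: "V * V' = 1\<^sub>m r"
    by (rule full_rank_factorization[OF A])
  have "r \<le> s" using factorization_width_le[OF U V U' UU V' VV] rank by (simp add: AUV)
  obtain Z W where "r \<le> c" and Z: "Z \<in> carrier_mat (c - r) c" and W: "W \<in> carrier_mat c (c - r)"
    and ZW: "Z * W = 1\<^sub>m (c - r)" and VW: "V * W = 0\<^sub>m r (c - r)" and ZV: "Z * V' = 0\<^sub>m (c - r) r"
    by (rule complementary_factorization[OF V V' VV])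
  define P where "P = mat s c (\<lambda>(i, j). if i < r then V $$ (i, j) else Z $$ (i - r, j))"
  define P' where "P' = mat c s (\<lambda>(i, j). if j < r then V' $$ (i, j) else W $$ (i, j - r))"
  define S where "S = mat n s (\<lambda>(i, j). if j < r then U $$ (i, j) else 0)"
  have "P * P' = 1\<^sub>m s"
  proof (rule eq_matI)
    fix i j assume "i < dim_row (1\<^sub>m s :: 'a mat)" "j < dim_col (1\<^sub>m s :: 'a mat)"
    then have ij: "i < s" "j < s" by auto
    have "(P * P') $$ (i, j) =
      (if i < r then if j < r then (V * V') $$ (i, j) else (V * W) $$ (i, j - r)
       else if j < r then (Z * V') $$ (i - r, j) else (Z * W) $$ (i - r, j - r))"
      using ij V V' Z W \<open>s \<le> c\<close> \<open>r \<le> s\<close> by (simp add: P_def P'_def scalar_prod_def)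
    also have "\<dots> = 1\<^sub>m s $$ (i, j)"
      unfolding VV VW ZV ZW using ij \<open>s \<le> c\<close> by auto
    finally show "(P * P') $$ (i, j) = 1\<^sub>m s $$ (i, j)" .
  qed (auto simp: P_def P'_def)
  moreover have "A = S * P"
  proof (rule eq_matI)
    fix i j assume "i < dim_row (S * P)" "j < dim_col (S * P)"
    then have ij: "i < n" "j < c" by (auto simp: P_def S_def)
    have "(S * P) $$ (i, j) = (\<Sum>l<s. (if l < r then U $$ (i, l) else 0) * P $$ (l, j))"
      using ij by (simp add: S_def P_def scalar_prod_def lessThan_atLeast0)
    also have "\<dots> = (\<Sum>l<r. U $$ (i, l) * V $$ (l, j))"
      using ij \<open>r \<le> s\<close> by (intro sum.mono_neutral_cong_right) (auto simp: P_def)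
    also have "\<dots> = A $$ (i, j)"
      using ij U V by (simp add: AUV scalar_prod_def lessThan_atLeast0)
    finally show "A $$ (i, j) = (S * P) $$ (i, j)" by simp
  qed (use A in \<open>auto simp: P_def S_def\<close>)
  moreover have "P \<in> carrier_mat s c" "P' \<in> carrier_mat c s" "S \<in> carrier_mat n s"
    by (auto simp: P_def P'_def S_def)
  ultimately show thesis using that by blast
qed

text \<open>
  The surjection \<open>B\<close> can be enlarged to a surjection \<open>G\<close> onto \<open>d\<close> dimensions that still annihilates
  \<open>A\<close>, as soon as there is room: the cokernel of \<open>A\<close> has dimension at least \<open>d\<close>. The new rows are
  independent functionals that vanish on the image of \<open>A\<close> and on that of \<open>B'\<close>.
\<close>

lemma extend_left_annihilator:
  fixes A B :: "'a::field_char_0 mat"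
  assumes B: "B \<in> carrier_mat c N" and B': "B' \<in> carrier_mat N c" and BB: "B * B' = 1\<^sub>m c"
    and A: "A \<in> carrier_mat N b" and BA: "B * A = 0\<^sub>m c b"
    and rank: "rank_le (N - d) A" and "c \<le> d" "d \<le> N"
  obtains G G' where "G \<in> carrier_mat d N" "G' \<in> carrier_mat N d" "G * G' = 1\<^sub>m d"
    "G * A = 0\<^sub>m d b" "mat c d (\<lambda>(i, j). if i = j then 1 else 0) * G = B"
proof -
  obtain r U V U' V' where
    U: "U \<in> carrier_mat N r" and V: "V \<in> carrier_mat r b" and AUV: "A = U * V"
    and U': "U' \<in> carrier_mat r N" and UU: "U' * U = 1\<^sub>m r"
    and V': "V' \<in> carrier_mat b r" and VV: "V * V' = 1\<^sub>m r"
    by (rule full_rank_factorization[OF A])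
  have r: "r \<le> N - d" using factorization_width_le[OF U V U' UU V' VV] rank by (simp add: AUV)
  have BU: "B * U = 0\<^sub>m c r"
    by (rule cancel_right_inverse[OF _ _ V V' VV])
      (use B U V BA assoc_mult_mat[OF B U V] in \<open>auto simp: AUV\<close>)
  \<comment> \<open>Correcting \<open>U'\<close> along the image of \<open>B'\<close> makes \<open>B\<close> and \<open>L\<close> dual to \<open>B'\<close> and \<open>U\<close>.\<close>
  define L where "L = U' - U' * B' * B"
  have UB: "U' * B' \<in> carrier_mat r c" and UBB: "U' * B' * B \<in> carrier_mat r N"
    using U' B B' by auto
  have L: "L \<in> carrier_mat r N" using UBB by (simp add: L_def minus_carrier_mat)
  have LU: "L * U = 1\<^sub>m r"
  proof -
    have "L * U = U' * U - U' * B' * B * U"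
      unfolding L_def by (rule minus_mult_distrib_mat[OF U' UBB U])
    also have "U' * B' * B * U = U' * B' * (B * U)" by (rule assoc_mult_mat[OF UB B U])
    also have "\<dots> = 0\<^sub>m r r" unfolding BU by (rule right_mult_zero_mat[OF UB])
    also have "U' * U - 0\<^sub>m r r = 1\<^sub>m r" unfolding UU by (intro eq_matI) auto
    finally show ?thesis .
  qed
  have LB: "L * B' = 0\<^sub>m r c"
  proof -
    have "L * B' = U' * B' - U' * B' * B * B'"
      unfolding L_def by (rule minus_mult_distrib_mat[OF U' UBB B'])
    also have "U' * B' * B * B' = U' * B' * (B * B')" by (rule assoc_mult_mat[OF UB B B'])
    also have "\<dots> = U' * B'" unfolding BB by (rule right_mult_one_mat[OF UB])
    finally show ?thesis using U' B' by simp
  qed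
  define X where "X = mat (c + r) N (\<lambda>(i, j). if i < c then B $$ (i, j) else L $$ (i - c, j))"
  define Y where "Y = mat N (c + r) (\<lambda>(i, j). if j < c then B' $$ (i, j) else U $$ (i, j - c))"
  have X: "X \<in> carrier_mat (c + r) N" and Y: "Y \<in> carrier_mat N (c + r)"
    by (auto simp: X_def Y_def)
  have "X * Y = 1\<^sub>m (c + r)"
  proof (rule eq_matI)
    fix i j assume "i < dim_row (1\<^sub>m (c + r) :: 'a mat)" "j < dim_col (1\<^sub>m (c + r) :: 'a mat)"
    then have ij: "i < c + r" "j < c + r" by auto
    have "(X * Y) $$ (i, j) =
      (if i < c then if j < c then (B * B') $$ (i, j) else (B * U) $$ (i, j - c)
       else if j < c then (L * B') $$ (i - c, j) else (L * U) $$ (i - c, j - c))"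
      using ij B B' L U by (simp add: X_def Y_def scalar_prod_def)
    also have "\<dots> = 1\<^sub>m (c + r) $$ (i, j)"
      unfolding BB BU LB LU using ij by auto
    finally show "(X * Y) $$ (i, j) = 1\<^sub>m (c + r) $$ (i, j)" .
  qed (auto simp: X_def Y_def)
  from complementary_factorization[OF X Y this] obtain Z W where
    Z: "Z \<in> carrier_mat (N - (c + r)) N" and W: "W \<in> carrier_mat N (N - (c + r))"
    and ZW: "Z * W = 1\<^sub>m (N - (c + r))" and XW: "X * W = 0\<^sub>m (c + r) (N - (c + r))"
    and ZY: "Z * Y = 0\<^sub>m (N - (c + r)) (c + r)" by blast
  have dcr: "d - c \<le> N - (c + r)" using r \<open>c \<le> d\<close> \<open>d \<le> N\<close> by simp
  have BW: "B * W = 0\<^sub>m c (N - (c + r))"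
  proof (rule eq_matI)
    fix i j assume ij: "i < dim_row (0\<^sub>m c (N - (c + r)) :: 'a mat)" "j < dim_col (0\<^sub>m c (N - (c + r)) :: 'a mat)"
    then have "(B * W) $$ (i, j) = (X * W) $$ (i, j)"
      using B W by (simp add: X_def scalar_prod_def)
    then show "(B * W) $$ (i, j) = 0\<^sub>m c (N - (c + r)) $$ (i, j)" using ij by (simp add: XW)
  qed (use B W in auto)
  have ZB: "Z * B' = 0\<^sub>m (N - (c + r)) c"
  proof (rule eq_matI)
    fix i j assume ij: "i < dim_row (0\<^sub>m (N - (c + r)) c :: 'a mat)" "j < dim_col (0\<^sub>m (N - (c + r)) c :: 'a mat)"
    then have "(Z * B') $$ (i, j) = (Z * Y) $$ (i, j)"
      using B' Z by (simp add: Y_def scalar_prod_def)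
    then show "(Z * B') $$ (i, j) = 0\<^sub>m (N - (c + r)) c $$ (i, j)" using ij by (simp add: ZY)
  qed (use B' Z in auto)
  have ZU: "Z * U = 0\<^sub>m (N - (c + r)) r"
  proof (rule eq_matI)
    fix i j assume ij: "i < dim_row (0\<^sub>m (N - (c + r)) r :: 'a mat)" "j < dim_col (0\<^sub>m (N - (c + r)) r :: 'a mat)"
    then have "(Z * U) $$ (i, j) = (Z * Y) $$ (i, c + j)"
      using U Z by (simp add: Y_def scalar_prod_def)
    then show "(Z * U) $$ (i, j) = 0\<^sub>m (N - (c + r)) r $$ (i, j)" using ij by (simp add: ZY)
  qed (use U Z in auto)
  have ZA: "Z * A = 0\<^sub>m (N - (c + r)) b"
    using assoc_mult_mat[OF Z U V] V by (simp add: AUV ZU)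
  define G where "G = mat d N (\<lambda>(i, j). if i < c then B $$ (i, j) else Z $$ (i - c, j))"
  define G' where "G' = mat N d (\<lambda>(i, j). if j < c then B' $$ (i, j) else W $$ (i, j - c))"
  have "G * G' = 1\<^sub>m d"
  proof (rule eq_matI)
    fix i j assume "i < dim_row (1\<^sub>m d :: 'a mat)" "j < dim_col (1\<^sub>m d :: 'a mat)"
    then have ij: "i < d" "j < d" by auto
    have "(G * G') $$ (i, j) =
      (if i < c then if j < c then (B * B') $$ (i, j) else (B * W) $$ (i, j - c)
       else if j < c then (Z * B') $$ (i - c, j) else (Z * W) $$ (i - c, j - c))"
      using ij B B' Z W dcr \<open>c \<le> d\<close> by (simp add: G_def G'_def scalar_prod_def)
    also have "\<dots> = 1\<^sub>m d $$ (i, j)"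
      unfolding BB BW ZB ZW using ij dcr by auto
    finally show "(G * G') $$ (i, j) = 1\<^sub>m d $$ (i, j)" .
  qed (auto simp: G_def G'_def)
  moreover have "G * A = 0\<^sub>m d b"
  proof (rule eq_matI)
    fix i j assume "i < dim_row (0\<^sub>m d b :: 'a mat)" "j < dim_col (0\<^sub>m d b :: 'a mat)"
    then have ij: "i < d" "j < b" by auto
    have "(G * A) $$ (i, j) = (if i < c then (B * A) $$ (i, j) else (Z * A) $$ (i - c, j))"
      using ij A B Z dcr by (simp add: G_def scalar_prod_def)
    also have "\<dots> = 0" unfolding BA ZA using ij dcr by auto
    finally show "(G * A) $$ (i, j) = 0\<^sub>m d b $$ (i, j)" using ij by simp
  qed (use A in \<open>auto simp: G_def\<close>)
  moreover have "mat c d (\<lambda>(i, j). if i = j then 1 else 0) * G = B"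
  proof (rule eq_matI)
    fix i j assume "i < dim_row B" "j < dim_col B"
    then have ij: "i < c" "j < N" using B by auto
    have "(mat c d (\<lambda>(i, j). if i = j then 1 else 0) * G) $$ (i, j)
        = (\<Sum>l<d. (if i = l then 1 else 0) * G $$ (l, j))"
      using ij by (simp add: G_def scalar_prod_def lessThan_atLeast0)
    also have "\<dots> = (\<Sum>l<d. if i = l then G $$ (l, j) else 0)" by (intro sum.cong) auto
    also have "\<dots> = G $$ (i, j)" using ij \<open>c \<le> d\<close> by simp
    also have "\<dots> = B $$ (i, j)" using ij \<open>c \<le> d\<close> by (simp add: G_def)
    finally show "(mat c d (\<lambda>(i, j). if i = j then 1 else 0) * G) $$ (i, j) = B $$ (i, j)" .
  qed (use B in \<open>auto simp: G_def\<close>)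
  moreover have "G \<in> carrier_mat d N" "G' \<in> carrier_mat N d" by (auto simp: G_def G'_def)
  ultimately show thesis using that by blast
qed

section \<open>Subspaces, kernels and one-sided inverses\<close>

abbreviation subspace_vec :: "nat \<Rightarrow> 'a::field vec set \<Rightarrow> bool" where
  "subspace_vec n W \<equiv> VectorSpace.subspace class_ring W (module_vec TYPE('a) n)"

lemma subspace_vec_iff:
  fixes W :: "'a::field vec set"
  shows "subspace_vec n W \<longleftrightarrow>
    W \<subseteq> carrier_vec n \<and> 0\<^sub>v n \<in> W \<and> (\<forall>x\<in>W. \<forall>y\<in>W. x + y \<in> W) \<and> (\<forall>a. \<forall>x\<in>W. a \<cdot>\<^sub>v x \<in> W)"
proof -
  have "vectorspace class_ring (module_vec TYPE('a) n)" by (rule vec_vs)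
  moreover have "module class_ring (module_vec TYPE('a) n)" by (rule vec_module)
  ultimately show ?thesis
    unfolding VectorSpace.subspace_def LinearCombinations.submodule_def
    by (simp add: module_vec_simps) blast
qed

lemma subspace_vec_carrier: "subspace_vec n (carrier_vec n)"
  by (simp add: subspace_vec_iff)

lemma subspace_vec_image:
  assumes M: "M \<in> carrier_mat n m" and W: "subspace_vec m W"
  shows "subspace_vec n ((\<lambda>x. M *\<^sub>v x) ` W)"
  unfolding subspace_vec_iff
proof (intro conjI ballI allI)
  note W' = W[unfolded subspace_vec_iff]
  show "(\<lambda>x. M *\<^sub>v x) ` W \<subseteq> carrier_vec n" using M W' by auto
  show "0\<^sub>v n \<in> (\<lambda>x. M *\<^sub>v x) ` W"
    using M W' by (intro image_eqI[of _ _ "0\<^sub>v m"]) auto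
  fix x y assume "x \<in> (\<lambda>x. M *\<^sub>v x) ` W" "y \<in> (\<lambda>x. M *\<^sub>v x) ` W"
  then obtain x' y' where xy: "x' \<in> W" "x = M *\<^sub>v x'" "y' \<in> W" "y = M *\<^sub>v y'" by auto
  then have "x + y = M *\<^sub>v (x' + y')"
    using W' mult_add_distrib_mat_vec[OF M, of x' y'] by (simp add: subset_iff)
  then show "x + y \<in> (\<lambda>x. M *\<^sub>v x) ` W" using xy W' by auto
next
  fix a x assume "x \<in> (\<lambda>x. M *\<^sub>v x) ` W"
  then obtain x' where x: "x' \<in> W" "x = M *\<^sub>v x'" by auto
  then have "a \<cdot>\<^sub>v x = M *\<^sub>v (a \<cdot>\<^sub>v x')"
    using W[unfolded subspace_vec_iff] mult_mat_vec[OF M, of x' a] by (simp add: subset_iff)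
  then show "a \<cdot>\<^sub>v x \<in> (\<lambda>x. M *\<^sub>v x) ` W" using x W[unfolded subspace_vec_iff] by auto
qed

lemma mult_mat_zero_vec:
  fixes M :: "'a::semiring_0 mat"
  assumes "M \<in> carrier_mat n m"
  shows "M *\<^sub>v 0\<^sub>v m = 0\<^sub>v n"
  using assms by (intro eq_vecI) auto

lemma subspace_vec_vimage:
  assumes M: "M \<in> carrier_mat n m" and W: "subspace_vec n W"
  shows "subspace_vec m {x \<in> carrier_vec m. M *\<^sub>v x \<in> W}"
proof -
  have "M *\<^sub>v 0\<^sub>v m = 0\<^sub>v n" using M by (intro eq_vecI) auto
  then show ?thesis
    using W M mult_add_distrib_mat_vec[OF M] mult_mat_vec[OF M]
    unfolding subspace_vec_iff by auto
qed

lemma mult_mat_vec_in_subspace: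
  fixes W :: "'a::field vec set"
  assumes W: "subspace_vec n W" and M: "M \<in> carrier_mat n m"
    and cols: "\<And>j. j < m \<Longrightarrow> col M j \<in> W" and x: "x \<in> carrier_vec m"
  shows "M *\<^sub>v x \<in> W"
proof -
  note W' = W[unfolded subspace_vec_iff]
  have "vec n (\<lambda>i. \<Sum>j<k. M $$ (i, j) * x $ j) \<in> W" if "k \<le> m" for k
    using that
  proof (induction k)
    case 0
    have "vec n (\<lambda>i. \<Sum>j<0. M $$ (i, j) * x $ j) = 0\<^sub>v n" by (intro eq_vecI) auto
    then show ?case using W' by simp
  next
    case (Suc k)
    have "vec n (\<lambda>i. \<Sum>j<Suc k. M $$ (i, j) * x $ j)
      = vec n (\<lambda>i. \<Sum>j<k. M $$ (i, j) * x $ j) + x $ k \<cdot>\<^sub>v col M k"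
      using M Suc.prems by (intro eq_vecI) auto
    then show ?case using Suc cols[of k] W' by simp
  qed
  from this[of m] have "vec n (\<lambda>i. \<Sum>j<m. M $$ (i, j) * x $ j) \<in> W" by simp
  also have "vec n (\<lambda>i. \<Sum>j<m. M $$ (i, j) * x $ j) = M *\<^sub>v x"
    using M x by (intro eq_vecI) (auto simp: scalar_prod_def lessThan_atLeast0)
  finally show ?thesis .
qed

lemma surjective_right_inverse:
  fixes M :: "'a::semiring_1 mat"
  assumes M: "M \<in> carrier_mat n m" and surj: "\<And>y. y \<in> carrier_vec n \<Longrightarrow> \<exists>x\<in>carrier_vec m. M *\<^sub>v x = y"
  obtains M' where "M' \<in> carrier_mat m n" "M * M' = 1\<^sub>m n"
proof -
  obtain x where x: "\<And>j. j < n \<Longrightarrow> x j \<in> carrier_vec m" "\<And>j. j < n \<Longrightarrow> M *\<^sub>v x j = unit_vec n j"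
    using surj[OF unit_vec_carrier] by metis
  define M' where "M' = mat m n (\<lambda>(i, j). x j $ i)"
  have "M * M' = 1\<^sub>m n"
  proof (rule eq_matI)
    fix i j assume "i < dim_row (1\<^sub>m n :: 'a mat)" "j < dim_col (1\<^sub>m n :: 'a mat)"
    then have ij: "i < n" "j < n" by auto
    have "col M' j = x j" using x(1)[OF ij(2)] ij by (intro eq_vecI) (auto simp: M'_def)
    then have "(M * M') $$ (i, j) = (M *\<^sub>v x j) $ i" using ij M by (simp add: M'_def)
    then show "(M * M') $$ (i, j) = 1\<^sub>m n $$ (i, j)" using x(2) ij by (simp add: unit_vec_def)
  qed (use M in \<open>auto simp: M'_def\<close>)
  then show thesis using that[of M'] by (simp add: M'_def)
qed

lemma right_inverse_surjective:
  fixes M :: "'a::semiring_1 mat"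
  assumes "M \<in> carrier_mat n m" "M' \<in> carrier_mat m n" "M * M' = 1\<^sub>m n" "y \<in> carrier_vec n"
  shows "M *\<^sub>v (M' *\<^sub>v y) = y"
  using assms assoc_mult_mat_vec[of M n m M' n y] by simp

lemma mult_mat_unit_vec:
  fixes M :: "'a::semiring_1 mat"
  assumes "M \<in> carrier_mat n m" "j < m"
  shows "M *\<^sub>v unit_vec m j = col M j"
  using assms by (intro eq_vecI) auto

text \<open>
  Since \<open>P\<close> annihilates \<open>1 - P' * P\<close>, so does \<open>S\<close>.
\<close>

lemma kernel_inclusion_factors:
  fixes P S :: "'a::comm_ring_1 mat"
  assumes P: "P \<in> carrier_mat s c" and P': "P' \<in> carrier_mat c s" and PP: "P * P' = 1\<^sub>m s"
    and S: "S \<in> carrier_mat n c" and ker: "\<And>x. x \<in> mat_kernel P \<Longrightarrow> S *\<^sub>v x = 0\<^sub>v n"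
  shows "S * P' * P = S"
proof (rule eq_matI)
  have PP': "P' * P \<in> carrier_mat c c" using P P' by auto
  fix i j assume "i < dim_row S" "j < dim_col S"
  then have ij: "i < n" "j < c" using S by auto
  let ?x = "unit_vec c j - P' * P *\<^sub>v unit_vec c j"
  have x: "?x \<in> carrier_vec c" using PP' by auto
  have "P *\<^sub>v ?x = P *\<^sub>v unit_vec c j - P *\<^sub>v (P' * P *\<^sub>v unit_vec c j)"
    using P PP' by (intro mult_minus_distrib_mat_vec) auto
  also have "P *\<^sub>v (P' * P *\<^sub>v unit_vec c j) = P *\<^sub>v unit_vec c j"
  proof -
    have "P *\<^sub>v (P' * P *\<^sub>v unit_vec c j) = (P * (P' * P)) *\<^sub>v unit_vec c j"
      using P PP' by (intro assoc_mult_mat_vec[symmetric]) auto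
    also have "P * (P' * P) = P" using assoc_mult_mat[OF P P' P] P by (simp add: PP)
    finally show ?thesis .
  qed
  finally have "?x \<in> mat_kernel P"
    using P x by (intro mat_kernelI[OF P]) auto
  then have "S *\<^sub>v ?x = 0\<^sub>v n" by (rule ker)
  also have "S *\<^sub>v ?x = S *\<^sub>v unit_vec c j - S *\<^sub>v (P' * P *\<^sub>v unit_vec c j)"
    using S PP' by (intro mult_minus_distrib_mat_vec) auto
  also have "S *\<^sub>v (P' * P *\<^sub>v unit_vec c j) = (S * (P' * P)) *\<^sub>v unit_vec c j"
    using S PP' by (intro assoc_mult_mat_vec[symmetric]) auto
  also have "S * (P' * P) = S * P' * P" using S P P' by (intro assoc_mult_mat[symmetric])
  also have "S *\<^sub>v unit_vec c j = col S j" using S ij(2) by (rule mult_mat_unit_vec)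
  also have "S * P' * P *\<^sub>v unit_vec c j = col (S * P' * P) j"
    using S P P' ij(2) by (intro mult_mat_unit_vec[where n = n]) auto
  finally have "(col S j - col (S * P' * P) j) $ i = 0" using ij by simp
  then show "(S * P' * P) $$ (i, j) = S $$ (i, j)"
    using ij S P P' by simp
qed (use S P P' in auto)

section \<open>Block rows and block columns\<close>

text \<open>
  The blocks are indexed by an unordered finite set, so the pairs (block, position in the block) are enumerated in an arbitrary way, the
  same one for block rows and block columns.
\<close>

definition block_index :: "'h set \<Rightarrow> ('h \<Rightarrow> nat) \<Rightarrow> nat \<Rightarrow> 'h \<times> nat" where
  "block_index H n = (SOME b. bij_betw b {..<\<Sum>h\<in>H. n h} (SIGMA h:H. {..<n h}))"

definition hcat :: "'h set \<Rightarrow> ('h \<Rightarrow> nat) \<Rightarrow> nat \<Rightarrow> ('h \<Rightarrow> 'a mat) \<Rightarrow> 'a mat" where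
  "hcat H n a P = mat a (\<Sum>h\<in>H. n h) (\<lambda>(i, s). case block_index H n s of (h, j) \<Rightarrow> P h $$ (i, j))"

definition vcat :: "'h set \<Rightarrow> ('h \<Rightarrow> nat) \<Rightarrow> nat \<Rightarrow> ('h \<Rightarrow> 'a mat) \<Rightarrow> 'a mat" where
  "vcat H n b S = mat (\<Sum>h\<in>H. n h) b (\<lambda>(s, j). case block_index H n s of (h, i) \<Rightarrow> S h $$ (i, j))"

lemma hcat_carrier [simp]: "hcat H n a P \<in> carrier_mat a (\<Sum>h\<in>H. n h)"
  by (simp add: hcat_def)

lemma vcat_carrier [simp]: "vcat H n b S \<in> carrier_mat (\<Sum>h\<in>H. n h) b"
  by (simp add: vcat_def)

lemma block_index_bij:
  assumes "finite H"
  shows "bij_betw (block_index H n) {..<\<Sum>h\<in>H. n h} (SIGMA h:H. {..<n h})"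
proof -
  have "finite (SIGMA h:H. {..<n h})" "card (SIGMA h:H. {..<n h}) = (\<Sum>h\<in>H. n h)"
    using assms by auto
  then have "\<exists>b. bij_betw b {..<\<Sum>h\<in>H. n h} (SIGMA h:H. {..<n h})"
    using ex_bij_betw_nat_finite[of "SIGMA h:H. {..<n h}"] by (simp add: lessThan_atLeast0)
  then show ?thesis unfolding block_index_def by (rule someI_ex)
qed

lemma block_indexE:
  assumes "finite H" "s < (\<Sum>h\<in>H. n h)"
  obtains h j where "block_index H n s = (h, j)" "h \<in> H" "j < n h"
proof -
  have "block_index H n s \<in> (SIGMA h:H. {..<n h})"
    using bij_betw_apply[OF block_index_bij[OF assms(1), of n]] assms(2) by simp
  then show thesis using that by (cases "block_index H n s") auto
qed

lemma block_index_surj: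
  assumes "finite H" "h \<in> H" "j < n h"
  obtains s where "s < (\<Sum>h\<in>H. n h)" "block_index H n s = (h, j)"
proof -
  have "(h, j) \<in> block_index H n ` {..<\<Sum>h\<in>H. n h}"
    using bij_betw_imp_surj_on[OF block_index_bij[OF assms(1), of n]] assms by auto
  then obtain s where "s < (\<Sum>h\<in>H. n h)" "block_index H n s = (h, j)" by auto
  then show thesis by (rule that)
qed

lemma hcat_vcat_index:
  fixes P S :: "'h \<Rightarrow> 'a::comm_semiring_0 mat"
  assumes "finite H"
    and P: "\<And>h. h \<in> H \<Longrightarrow> P h \<in> carrier_mat a (n h)"
    and S: "\<And>h. h \<in> H \<Longrightarrow> S h \<in> carrier_mat (n h) b"
    and "i < a" "j < b"
  shows "(hcat H n a P * vcat H n b S) $$ (i, j) = (\<Sum>h\<in>H. (P h * S h) $$ (i, j))"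
proof -
  have "(hcat H n a P * vcat H n b S) $$ (i, j)
      = (\<Sum>s<(\<Sum>h\<in>H. n h). case block_index H n s of (h, l) \<Rightarrow> P h $$ (i, l) * S h $$ (l, j))"
    using \<open>i < a\<close> \<open>j < b\<close>
    by (auto simp: hcat_def vcat_def scalar_prod_def lessThan_atLeast0 split: prod.split intro!: sum.cong)
  also have "\<dots> = (\<Sum>(h, l)\<in>(SIGMA h:H. {..<n h}). P h $$ (i, l) * S h $$ (l, j))"
    by (rule sum.reindex_bij_betw[OF block_index_bij[OF \<open>finite H\<close>]])
  also have "\<dots> = (\<Sum>h\<in>H. \<Sum>l<n h. P h $$ (i, l) * S h $$ (l, j))"
    using \<open>finite H\<close> by (subst sum.Sigma) auto
  also have "\<dots> = (\<Sum>h\<in>H. (P h * S h) $$ (i, j))"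
    using P S \<open>i < a\<close> \<open>j < b\<close>
    by (intro sum.cong refl) (force simp: scalar_prod_def lessThan_atLeast0)
  finally show ?thesis .
qed

lemma hcat_vcat_eq_0_iff:
  fixes P S :: "'h \<Rightarrow> 'a::comm_semiring_0 mat"
  assumes "finite H"
    and P: "\<And>h. h \<in> H \<Longrightarrow> P h \<in> carrier_mat a (n h)"
    and S: "\<And>h. h \<in> H \<Longrightarrow> S h \<in> carrier_mat (n h) b"
  shows "hcat H n a P * vcat H n b S = 0\<^sub>m a b \<longleftrightarrow>
    (\<forall>i<a. \<forall>j<b. (\<Sum>h\<in>H. (P h * S h) $$ (i, j)) = 0)"
proof
  assume "hcat H n a P * vcat H n b S = 0\<^sub>m a b"
  then have "(hcat H n a P * vcat H n b S) $$ (i, j) = 0" if "i < a" "j < b" for i j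
    using that by simp
  then show "\<forall>i<a. \<forall>j<b. (\<Sum>h\<in>H. (P h * S h) $$ (i, j)) = 0"
    using hcat_vcat_index[where P = P and S = S and n = n, OF assms] by simp
next
  assume *: "\<forall>i<a. \<forall>j<b. (\<Sum>h\<in>H. (P h * S h) $$ (i, j)) = 0"
  show "hcat H n a P * vcat H n b S = 0\<^sub>m a b"
  proof (rule eq_matI)
    fix i j assume "i < dim_row (0\<^sub>m a b :: 'a mat)" "j < dim_col (0\<^sub>m a b :: 'a mat)"
    then have "i < a" "j < b" by auto
    then show "(hcat H n a P * vcat H n b S) $$ (i, j) = 0\<^sub>m a b $$ (i, j)"
      using * hcat_vcat_index[where P = P and S = S and n = n, OF assms] by simp
  qed (auto simp: hcat_def vcat_def)
qed

text \<open>
  The product of a block row and a block column depends only on the products of the matching blocks, so a factor of each block may be moved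
  from one side to the other even if this changes the widths of the blocks.
\<close>

lemma hcat_vcat_zero_transfer:
  fixes P S P' S' :: "'h \<Rightarrow> 'a::comm_semiring_0 mat"
  assumes fin: "finite H"
    and P: "\<And>h. h \<in> H \<Longrightarrow> P h \<in> carrier_mat a (n h)"
    and S: "\<And>h. h \<in> H \<Longrightarrow> S h \<in> carrier_mat (n h) b"
    and P': "\<And>h. h \<in> H \<Longrightarrow> P' h \<in> carrier_mat a (n' h)"
    and S': "\<And>h. h \<in> H \<Longrightarrow> S' h \<in> carrier_mat (n' h) b"
    and eq: "\<And>h. h \<in> H \<Longrightarrow> P h * S h = P' h * S' h"
    and zero: "hcat H n' a P' * vcat H n' b S' = 0\<^sub>m a b"
  shows "hcat H n a P * vcat H n b S = 0\<^sub>m a b"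
proof -
  have "\<forall>i<a. \<forall>j<b. (\<Sum>h\<in>H. (P' h * S' h) $$ (i, j)) = 0"
    using hcat_vcat_eq_0_iff[where P = P' and S = S' and n = n', OF fin P' S'] zero by blast
  moreover have "(\<Sum>h\<in>H. (P h * S h) $$ (i, j)) = (\<Sum>h\<in>H. (P' h * S' h) $$ (i, j))" for i j
    by (intro sum.cong refl) (simp only: eq)
  ultimately have "\<forall>i<a. \<forall>j<b. (\<Sum>h\<in>H. (P h * S h) $$ (i, j)) = 0" by simp
  then show ?thesis
    using hcat_vcat_eq_0_iff[where P = P and S = S and n = n, OF fin P S] by blast
qed

lemma mult_hcat:
  fixes P :: "'h \<Rightarrow> 'a::semiring_0 mat"
  assumes "finite H" and X: "X \<in> carrier_mat b a"
    and P: "\<And>h. h \<in> H \<Longrightarrow> P h \<in> carrier_mat a (n h)"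
  shows "X * hcat H n a P = hcat H n b (\<lambda>h. X * P h)"
proof (rule eq_matI)
  fix i s assume "i < dim_row (hcat H n b (\<lambda>h. X * P h))" "s < dim_col (hcat H n b (\<lambda>h. X * P h))"
  then have i: "i < b" and s: "s < (\<Sum>h\<in>H. n h)" by (auto simp: hcat_def)
  obtain h j where "block_index H n s = (h, j)" "h \<in> H" "j < n h"
    using block_indexE[OF \<open>finite H\<close> s] .
  then show "(X * hcat H n a P) $$ (i, s) = hcat H n b (\<lambda>h. X * P h) $$ (i, s)"
    using i s X P[of h] by (simp add: hcat_def scalar_prod_def)
qed (use X in \<open>auto simp: hcat_def\<close>)

lemma vcat_mult:
  fixes S :: "'h \<Rightarrow> 'a::semiring_0 mat"
  assumes "finite H" and X: "X \<in> carrier_mat a b"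
    and S: "\<And>h. h \<in> H \<Longrightarrow> S h \<in> carrier_mat (n h) a"
  shows "vcat H n a S * X = vcat H n b (\<lambda>h. S h * X)"
proof (rule eq_matI)
  fix s i assume "s < dim_row (vcat H n b (\<lambda>h. S h * X))" "i < dim_col (vcat H n b (\<lambda>h. S h * X))"
  then have i: "i < b" and s: "s < (\<Sum>h\<in>H. n h)" by (auto simp: vcat_def)
  obtain h j where "block_index H n s = (h, j)" "h \<in> H" "j < n h"
    using block_indexE[OF \<open>finite H\<close> s] .
  then show "(vcat H n a S * X) $$ (s, i) = vcat H n b (\<lambda>h. S h * X) $$ (s, i)"
    using i s X S[of h] by (simp add: vcat_def scalar_prod_def)
qed (use X in \<open>auto simp: vcat_def\<close>)

lemma vcat_cong:
  assumes "finite H" "\<And>h. h \<in> H \<Longrightarrow> S h = S' h"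
  shows "vcat H n b S = vcat H n b S'"
proof (rule eq_matI)
  fix s i assume "s < dim_row (vcat H n b S')" "i < dim_col (vcat H n b S')"
  then have i: "i < b" and s: "s < (\<Sum>h\<in>H. n h)" by (auto simp: vcat_def)
  obtain h j where "block_index H n s = (h, j)" "h \<in> H"
    using block_indexE[OF \<open>finite H\<close> s] .
  then show "vcat H n b S $$ (s, i) = vcat H n b S' $$ (s, i)"
    using i s assms(2) by (simp add: vcat_def)
qed (auto simp: vcat_def)

lemma hcat_inject:
  assumes "finite H" and "hcat H n a P = hcat H n a P'" and "h \<in> H"
    and "P h \<in> carrier_mat a (n h)" "P' h \<in> carrier_mat a (n h)"
  shows "P h = P' h"
proof (rule eq_matI)
  fix i j assume "i < dim_row (P' h)" "j < dim_col (P' h)"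
  then have i: "i < a" and j: "j < n h" using assms by auto
  obtain s where s: "s < (\<Sum>h\<in>H. n h)" "block_index H n s = (h, j)"
    using block_index_surj[where n = n, OF \<open>finite H\<close> \<open>h \<in> H\<close> j] .
  have "hcat H n a P $$ (i, s) = hcat H n a P' $$ (i, s)" using assms(2) by simp
  then show "P h $$ (i, j) = P' h $$ (i, j)" using i s by (simp add: hcat_def)
qed (use assms in auto)

lemma vcat_inject:
  assumes "finite H" and "vcat H n b S = vcat H n b S'" and "h \<in> H"
    and "S h \<in> carrier_mat (n h) b" "S' h \<in> carrier_mat (n h) b"
  shows "S h = S' h"
proof (rule eq_matI)
  fix j i assume "j < dim_row (S' h)" "i < dim_col (S' h)"
  then have i: "i < b" and j: "j < n h" using assms by auto
  obtain s where s: "s < (\<Sum>h\<in>H. n h)" "block_index H n s = (h, j)"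
    using block_index_surj[where n = n, OF \<open>finite H\<close> \<open>h \<in> H\<close> j] .
  have "vcat H n b S $$ (s, i) = vcat H n b S' $$ (s, i)" using assms(2) by simp
  then show "S h $$ (j, i) = S' h $$ (j, i)" using i s by (simp add: vcat_def)
qed (use assms in auto)

lemma hcat_cases:
  assumes "finite H" and G: "G \<in> carrier_mat a (\<Sum>h\<in>H. n h)"
  obtains P where "\<And>h. h \<in> H \<Longrightarrow> P h \<in> carrier_mat a (n h)" "G = hcat H n a P"
proof
  let ?inv = "the_inv_into {..<\<Sum>h\<in>H. n h} (block_index H n)"
  let ?P = "\<lambda>h. mat a (n h) (\<lambda>(i, j). G $$ (i, ?inv (h, j)))"
  show "?P h \<in> carrier_mat a (n h)" for h by simp
  show "G = hcat H n a ?P"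
  proof (rule eq_matI)
    fix i s assume "i < dim_row (hcat H n a ?P)" "s < dim_col (hcat H n a ?P)"
    then have i: "i < a" and s: "s < (\<Sum>h\<in>H. n h)" by (auto simp: hcat_def)
    obtain h j where hj: "block_index H n s = (h, j)" "h \<in> H" "j < n h"
      using block_indexE[OF \<open>finite H\<close> s] .
    have "?inv (h, j) = s"
      using the_inv_into_f_f[OF bij_betw_imp_inj_on[OF block_index_bij[OF \<open>finite H\<close>, of n]], of s] s
      by (simp add: hj)
    then show "G $$ (i, s) = hcat H n a ?P $$ (i, s)" using i s hj by (simp add: hcat_def)
  qed (use G in \<open>auto simp: hcat_def\<close>)
qed

lemma hcat_col:
  assumes "finite H" "s < (\<Sum>h\<in>H. n h)"
    and P: "\<And>h. h \<in> H \<Longrightarrow> P h \<in> carrier_mat a (n h)"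
  obtains h j where "h \<in> H" "j < n h" "col (hcat H n a P) s = col (P h) j"
proof -
  obtain h j where hj: "block_index H n s = (h, j)" "h \<in> H" "j < n h"
    using block_indexE[OF assms(1,2)] .
  moreover have "col (hcat H n a P) s = col (P h) j"
    using hj assms(2) P[of h] by (intro eq_vecI) (auto simp: hcat_def)
  ultimately show thesis using that by blast
qed

lemma col_hcat_exists:
  assumes "finite H" "h \<in> H" "j < n h" and P: "P h \<in> carrier_mat a (n h)"
  obtains s where "s < (\<Sum>h\<in>H. n h)" "col (hcat H n a P) s = col (P h) j"
proof -
  obtain s where s: "s < (\<Sum>h\<in>H. n h)" "block_index H n s = (h, j)"
    using block_index_surj[where n = n, OF assms(1-3)] .
  moreover have "col (hcat H n a P) s = col (P h) j"
    using s assms(3) P by (intro eq_vecI) (auto simp: hcat_def)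
  ultimately show thesis using that by blast
qed

lemma hcat_image:
  fixes P :: "'h \<Rightarrow> 'a::field mat"
  assumes "finite H" "h \<in> H" and P: "P h \<in> carrier_mat a (n h)"
    and x: "x \<in> carrier_vec (n h)"
  shows "P h *\<^sub>v x \<in> (\<lambda>y. hcat H n a P *\<^sub>v y) ` carrier_vec (\<Sum>h\<in>H. n h)"
proof (rule mult_mat_vec_in_subspace[OF _ P _ x])
  show "subspace_vec a ((\<lambda>y. hcat H n a P *\<^sub>v y) ` carrier_vec (\<Sum>h\<in>H. n h))"
    by (rule subspace_vec_image[OF hcat_carrier subspace_vec_carrier])
  fix j assume "j < n h"
  then obtain s where s: "s < (\<Sum>h\<in>H. n h)" "col (hcat H n a P) s = col (P h) j"
    using col_hcat_exists[where P = P and n = n, OF assms(1,2) _ P] by blast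
  then have "col (P h) j = hcat H n a P *\<^sub>v unit_vec (\<Sum>h\<in>H. n h) s"
    using mult_mat_unit_vec[OF hcat_carrier[of H n a P] s(1)] by simp
  then show "col (P h) j \<in> (\<lambda>y. hcat H n a P *\<^sub>v y) ` carrier_vec (\<Sum>h\<in>H. n h)"
    by (rule image_eqI) simp
qed

section \<open>The maps into and out of a vertex\<close>

text \<open>
  The half-arrows at a vertex of the doubled framed quiver. A loop at \<open>v\<close> contributes two different slots to \<open>v\<close>,
  one \<open>Into\<close> and one \<open>Outof\<close>.
\<close>

datatype 'e slot = Into 'e | Outof 'e | Frame

definition slots :: "('v, 'e) pre_digraph \<Rightarrow> 'v \<Rightarrow> 'e slot set" where
  "slots Q v = Into ` {e \<in> arcs Q. head Q e = v} \<union> Outof ` {e \<in> arcs Q. tail Q e = v} \<union> {Frame}"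

text \<open>
  A dimension, a subspace (\<open>slot_space\<close>) and a linear map (\<open>slot_map\<close>) are read off at the other end of a slot. At
  the other end of the framing slot sits the framing space, on which every morphism is the identity.
\<close>

definition slot_dim :: "('v, 'e) pre_digraph \<Rightarrow> ('v \<Rightarrow> nat) \<Rightarrow> ('v \<Rightarrow> nat) \<Rightarrow> 'v \<Rightarrow> 'e slot \<Rightarrow> nat" where
  "slot_dim Q d f v h = (case h of Into e \<Rightarrow> d (tail Q e) | Outof e \<Rightarrow> d (head Q e) | Frame \<Rightarrow> f v)"

definition slot_space ::
  "('v, 'e) pre_digraph \<Rightarrow> ('v \<Rightarrow> nat) \<Rightarrow> ('v \<Rightarrow> complex vec set) \<Rightarrow> 'v \<Rightarrow> 'e slot \<Rightarrow> complex vec set" where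
  "slot_space Q f W v h =
     (case h of Into e \<Rightarrow> W (tail Q e) | Outof e \<Rightarrow> W (head Q e) | Frame \<Rightarrow> carrier_vec (f v))"

definition slot_map ::
  "('v, 'e) pre_digraph \<Rightarrow> ('v \<Rightarrow> nat) \<Rightarrow> ('v \<Rightarrow> complex mat) \<Rightarrow> 'v \<Rightarrow> 'e slot \<Rightarrow> complex mat" where
  "slot_map Q f \<pi> v h =
     (case h of Into e \<Rightarrow> \<pi> (tail Q e) | Outof e \<Rightarrow> \<pi> (head Q e) | Frame \<Rightarrow> 1\<^sub>m (f v))"

definition inmap :: "('v, 'e) framed_rep \<Rightarrow> 'v \<Rightarrow> 'e slot \<Rightarrow> complex mat" where
  "inmap R v h = (case h of Into e \<Rightarrow> mapA R e | Outof e \<Rightarrow> mapB R e | Frame \<Rightarrow> mapI R v)"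

text \<open>
  The sign makes the left-hand side of the moment map equation at \<open>v\<close> equal to the sum over the slots of the products of
  incoming and outgoing maps.
\<close>

definition outmap :: "('v, 'e) framed_rep \<Rightarrow> 'v \<Rightarrow> 'e slot \<Rightarrow> complex mat" where
  "outmap R v h = (case h of Into e \<Rightarrow> mapB R e | Outof e \<Rightarrow> - mapA R e | Frame \<Rightarrow> mapJ R v)"

definition total_slot_dim :: "('v, 'e) pre_digraph \<Rightarrow> ('v \<Rightarrow> nat) \<Rightarrow> ('v \<Rightarrow> nat) \<Rightarrow> 'v \<Rightarrow> nat" where
  "total_slot_dim Q d f v = (\<Sum>h\<in>slots Q v. slot_dim Q d f v h)"

text \<open>
  With the following definition, this gives the complex \<open>D v \<rightarrow> (direct sum over the slots) \<rightarrow> D v\<close>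
  attached to a vertex: \<open>outgoing\<close> is its first map, and \<open>incoming\<close> its second one.
\<close>

definition incoming ::
  "('v, 'e) pre_digraph \<Rightarrow> ('v \<Rightarrow> nat) \<Rightarrow> ('v \<Rightarrow> nat) \<Rightarrow> ('v, 'e) framed_rep \<Rightarrow> 'v \<Rightarrow> complex mat" where
  "incoming Q d f R v = hcat (slots Q v) (slot_dim Q d f v) (d v) (inmap R v)"

definition outgoing ::
  "('v, 'e) pre_digraph \<Rightarrow> ('v \<Rightarrow> nat) \<Rightarrow> ('v \<Rightarrow> nat) \<Rightarrow> ('v, 'e) framed_rep \<Rightarrow> 'v \<Rightarrow> complex mat" where
  "outgoing Q d f R v = vcat (slots Q v) (slot_dim Q d f v) (d v) (outmap R v)"

lemma incoming_carrier: "incoming Q d f R v \<in> carrier_mat (d v) (total_slot_dim Q d f v)"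
  by (simp add: incoming_def total_slot_dim_def)

lemma outgoing_carrier: "outgoing Q d f R v \<in> carrier_mat (total_slot_dim Q d f v) (d v)"
  by (simp add: outgoing_def total_slot_dim_def)

lemma slotE [consumes 1, case_names Into Outof Frame]:
  assumes "h \<in> slots Q v"
  obtains e where "h = Into e" "e \<in> arcs Q" "head Q e = v"
    | e where "h = Outof e" "e \<in> arcs Q" "tail Q e = v"
    | "h = Frame"
  using assms by (auto simp: slots_def)

lemma slotI:
  "e \<in> arcs Q \<Longrightarrow> Into e \<in> slots Q (head Q e)"
  "e \<in> arcs Q \<Longrightarrow> Outof e \<in> slots Q (tail Q e)"
  "Frame \<in> slots Q v"
  by (auto simp: slots_def)

lemma ball_slots_iff:
  assumes "wf_digraph Q"
  shows "(\<forall>v\<in>verts Q. \<forall>h\<in>slots Q v. \<Phi> v h) \<longleftrightarrow>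
    (\<forall>e\<in>arcs Q. \<Phi> (head Q e) (Into e)) \<and> (\<forall>e\<in>arcs Q. \<Phi> (tail Q e) (Outof e)) \<and>
    (\<forall>v\<in>verts Q. \<Phi> v Frame)"
proof
  assume *: "\<forall>v\<in>verts Q. \<forall>h\<in>slots Q v. \<Phi> v h"
  have "\<Phi> (head Q e) (Into e)" "\<Phi> (tail Q e) (Outof e)" if "e \<in> arcs Q" for e
    using *[rule_format, OF wf_digraph.head_in_verts[OF assms that] slotI(1)[OF that]]
      *[rule_format, OF wf_digraph.tail_in_verts[OF assms that] slotI(2)[OF that]] by simp_all
  moreover have "\<Phi> v Frame" if "v \<in> verts Q" for v
    by (rule *[rule_format, OF that slotI(3)])
  ultimately show "(\<forall>e\<in>arcs Q. \<Phi> (head Q e) (Into e)) \<and> (\<forall>e\<in>arcs Q. \<Phi> (tail Q e) (Outof e)) \<and>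
    (\<forall>v\<in>verts Q. \<Phi> v Frame)" by simp
next
  assume *: "(\<forall>e\<in>arcs Q. \<Phi> (head Q e) (Into e)) \<and> (\<forall>e\<in>arcs Q. \<Phi> (tail Q e) (Outof e)) \<and>
    (\<forall>v\<in>verts Q. \<Phi> v Frame)"
  have "\<Phi> v h" if "v \<in> verts Q" "h \<in> slots Q v" for v h
    using that(2)
  proof (cases rule: slotE)
    case (Into e)
    then show ?thesis using * by auto
  next
    case (Outof e)
    then show ?thesis using * by auto
  next
    case Frame
    then show ?thesis using * that(1) by simp
  qed
  then show "\<forall>v\<in>verts Q. \<forall>h\<in>slots Q v. \<Phi> v h" by simp
qed

lemma slot_space_cong:
  assumes "wf_digraph Q" "h \<in> slots Q v" "\<And>v. v \<in> verts Q \<Longrightarrow> W v = W' v"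
  shows "slot_space Q f W v h = slot_space Q f W' v h"
  using assms(2)
  by (cases rule: slotE) (simp_all add: slot_space_def assms(3) wf_digraph.head_in_verts[OF assms(1)]
      wf_digraph.tail_in_verts[OF assms(1)])

lemma slot_space_carrier:
  "slot_space Q f (\<lambda>v. carrier_vec (d v)) v h = carrier_vec (slot_dim Q d f v h)"
  by (simp add: slot_space_def slot_dim_def split: slot.split)

lemma slot_space_image:
  "slot_space Q f (\<lambda>v. (\<lambda>x. \<pi> v *\<^sub>v x) ` W v) v h = (\<lambda>x. slot_map Q f \<pi> v h *\<^sub>v x) ` slot_space Q f W v h"
proof (cases h)
  case Frame
  have "(\<lambda>x. 1\<^sub>m (f v) *\<^sub>v x) ` carrier_vec (f v) = (\<lambda>x :: complex vec. x) ` carrier_vec (f v)"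
    by (intro image_cong) auto
  then show ?thesis using Frame by (simp add: slot_space_def slot_map_def)
qed (simp_all add: slot_space_def slot_map_def)

lemma slot_space_subset:
  assumes "wf_digraph Q" "h \<in> slots Q v" "\<And>v. v \<in> verts Q \<Longrightarrow> W v \<subseteq> carrier_vec (d v)"
  shows "slot_space Q f W v h \<subseteq> carrier_vec (slot_dim Q d f v h)"
  using assms(2)
  by (cases rule: slotE) (simp_all add: slot_space_def slot_dim_def assms(3)
      wf_digraph.head_in_verts[OF assms(1)] wf_digraph.tail_in_verts[OF assms(1)])

lemma slot_map_carrier:
  assumes "wf_digraph Q" "h \<in> slots Q v"
    and "\<And>v. v \<in> verts Q \<Longrightarrow> \<pi> v \<in> carrier_mat (d1 v) (d0 v)"
  shows "slot_map Q f \<pi> v h \<in> carrier_mat (slot_dim Q d1 f v h) (slot_dim Q d0 f v h)"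
  using assms(2)
  by (cases rule: slotE) (simp_all add: slot_map_def slot_dim_def
      assms(3) wf_digraph.head_in_verts[OF assms(1)] wf_digraph.tail_in_verts[OF assms(1)])

lemma framed_reps_mem:
  assumes "R \<in> framed_reps Q d f"
  shows "e \<in> arcs Q \<Longrightarrow> mapA R e \<in> carrier_mat (d (head Q e)) (d (tail Q e))"
    "e \<in> arcs Q \<Longrightarrow> mapB R e \<in> carrier_mat (d (tail Q e)) (d (head Q e))"
    "v \<in> verts Q \<Longrightarrow> mapI R v \<in> carrier_mat (d v) (f v)"
    "v \<in> verts Q \<Longrightarrow> mapJ R v \<in> carrier_mat (f v) (d v)"
proof -
  have "mapA R \<in> (\<Pi>\<^sub>E e\<in>arcs Q. carrier_mat (d (head Q e)) (d (tail Q e)))"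
    "mapB R \<in> (\<Pi>\<^sub>E e\<in>arcs Q. carrier_mat (d (tail Q e)) (d (head Q e)))"
    "mapI R \<in> (\<Pi>\<^sub>E v\<in>verts Q. carrier_mat (d v) (f v))"
    "mapJ R \<in> (\<Pi>\<^sub>E v\<in>verts Q. carrier_mat (f v) (d v))"
    using assms by (simp_all add: framed_reps_def)
  note mem = this[THEN PiE_mem]
  show "e \<in> arcs Q \<Longrightarrow> mapA R e \<in> carrier_mat (d (head Q e)) (d (tail Q e))" by (rule mem(1))
  show "e \<in> arcs Q \<Longrightarrow> mapB R e \<in> carrier_mat (d (tail Q e)) (d (head Q e))" by (rule mem(2))
  show "v \<in> verts Q \<Longrightarrow> mapI R v \<in> carrier_mat (d v) (f v)" by (rule mem(3))
  show "v \<in> verts Q \<Longrightarrow> mapJ R v \<in> carrier_mat (f v) (d v)" by (rule mem(4))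
qed

lemma inmap_carrier:
  assumes "R \<in> framed_reps Q d f" "v \<in> verts Q" "h \<in> slots Q v"
  shows "inmap R v h \<in> carrier_mat (d v) (slot_dim Q d f v h)"
  using assms(3)
proof (cases rule: slotE)
  case (Into e)
  then show ?thesis using framed_reps_mem(1)[OF assms(1), of e] by (simp add: inmap_def slot_dim_def)
next
  case (Outof e)
  then show ?thesis using framed_reps_mem(2)[OF assms(1), of e] by (simp add: inmap_def slot_dim_def)
next
  case Frame
  then show ?thesis using framed_reps_mem(3)[OF assms(1,2)] by (simp add: inmap_def slot_dim_def)
qed

lemma outmap_carrier:
  assumes "R \<in> framed_reps Q d f" "v \<in> verts Q" "h \<in> slots Q v"
  shows "outmap R v h \<in> carrier_mat (slot_dim Q d f v h) (d v)"
  using assms(3)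
proof (cases rule: slotE)
  case (Into e)
  then show ?thesis using framed_reps_mem(2)[OF assms(1), of e] by (simp add: outmap_def slot_dim_def)
next
  case (Outof e)
  then show ?thesis using framed_reps_mem(1)[OF assms(1), of e] by (simp add: outmap_def slot_dim_def)
next
  case Frame
  then show ?thesis using framed_reps_mem(4)[OF assms(1,2)] by (simp add: outmap_def slot_dim_def)
qed

lemma finite_slots: "fin_digraph Q \<Longrightarrow> finite (slots Q v)"
  by (simp add: slots_def fin_digraph.finite_arcs)

lemma sum_slots:
  fixes g :: "'e slot \<Rightarrow> 'a::comm_monoid_add"
  assumes "fin_digraph Q"
  shows "(\<Sum>h\<in>slots Q v. g h) =
    (\<Sum>e | e \<in> arcs Q \<and> head Q e = v. g (Into e)) + (\<Sum>e | e \<in> arcs Q \<and> tail Q e = v. g (Outof e))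
    + g Frame"
proof -
  have fin: "finite (arcs Q)" using assms by (rule fin_digraph.finite_arcs)
  have "(\<Sum>h\<in>slots Q v. g h) = (\<Sum>h\<in>Into ` {e \<in> arcs Q. head Q e = v}. g h)
      + (\<Sum>h\<in>Outof ` {e \<in> arcs Q. tail Q e = v}. g h) + (\<Sum>h\<in>{Frame}. g h)"
    unfolding slots_def using fin by (subst sum.union_disjoint; force?)+
  then show ?thesis by (simp add: sum.reindex inj_on_def)
qed

text \<open>
  Grouping the arrows at \<open>v\<close> by their other end identifies the sum in \<open>k0\<close>, together with the framing term, as the
  dimension of the middle term of the complex at \<open>v\<close>.
\<close>

lemma k0_eq_total_slot_dim:
  assumes Q: "fin_digraph Q" and c: "\<And>w. w \<in> verts Q \<Longrightarrow> c w = int (n w)" and v: "v \<in> verts Q"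
  shows "k0 Q f c v = 2 * int (n v) - int (total_slot_dim Q n f v)"
proof -
  have wf: "wf_digraph Q" using Q by (rule fin_digraph.axioms(1))
  have fa: "finite (arcs Q)" and fv: "finite (verts Q)"
    using Q by (rule fin_digraph.finite_arcs, rule fin_digraph.finite_verts)
  have out: "(\<Sum>w\<in>verts Q. card (arrows_between Q v w) * n w) = (\<Sum>e | e \<in> arcs Q \<and> tail Q e = v. n (head Q e))"
  proof -
    have "(\<Sum>e | e \<in> arcs Q \<and> tail Q e = v. n (head Q e))
        = (\<Sum>w\<in>verts Q. \<Sum>e\<in>{e \<in> {e \<in> arcs Q. tail Q e = v}. head Q e = w}. n (head Q e))"
      using fa fv wf_digraph.head_in_verts[OF wf] by (intro sum.group[symmetric]) auto
    also have "\<dots> = (\<Sum>w\<in>verts Q. card (arrows_between Q v w) * n w)"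
      by (intro sum.cong refl) (simp add: arrows_between_def conj_assoc)
    finally show ?thesis by simp
  qed
  have into: "(\<Sum>w\<in>verts Q. card (arrows_between Q w v) * n w) = (\<Sum>e | e \<in> arcs Q \<and> head Q e = v. n (tail Q e))"
  proof -
    have "(\<Sum>e | e \<in> arcs Q \<and> head Q e = v. n (tail Q e))
        = (\<Sum>w\<in>verts Q. \<Sum>e\<in>{e \<in> {e \<in> arcs Q. head Q e = v}. tail Q e = w}. n (tail Q e))"
      using fa fv wf_digraph.tail_in_verts[OF wf] by (intro sum.group[symmetric]) auto
    also have "\<dots> = (\<Sum>w\<in>verts Q. card (arrows_between Q w v) * n w)"
      by (intro sum.cong refl) (simp add: arrows_between_def conj_commute conj_left_commute)
    finally show ?thesis by simp
  qed
  have "total_slot_dim Q n f v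
      = (\<Sum>w\<in>verts Q. (card (arrows_between Q v w) + card (arrows_between Q w v)) * n w) + f v"
    unfolding total_slot_dim_def sum_slots[OF Q] distrib_right sum.distrib out into
    by (simp add: slot_dim_def)
  then have "int (total_slot_dim Q n f v)
      = (\<Sum>w\<in>verts Q. int (card (arrows_between Q v w) + card (arrows_between Q w v)) * c w) + int (f v)"
    by (simp add: c cong: sum.cong)
  then show ?thesis by (simp add: k0_def c[OF v])
qed

section \<open>The moment map and stability in terms of slots\<close>

lemma zero_mat_iff:
  assumes "M \<in> carrier_mat n m"
  shows "M = 0\<^sub>m n m \<longleftrightarrow> (\<forall>i<n. \<forall>j<m. M $$ (i, j) = 0)"
proof
  assume "\<forall>i<n. \<forall>j<m. M $$ (i, j) = 0"
  then show "M = 0\<^sub>m n m" using assms by (intro eq_matI) auto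
qed simp

lemma finsum_ring_mat:
  fixes g :: "'b \<Rightarrow> 'a::comm_ring_1 mat"
  assumes "finite F" "\<And>x. x \<in> F \<Longrightarrow> g x \<in> carrier_mat n n"
  shows "finsum (ring_mat TYPE('a) n b) g F = mat n n (\<lambda>(i, j). \<Sum>x\<in>F. g x $$ (i, j))"
proof -
  interpret ring "ring_mat TYPE('a) n b" by (rule ring_mat)
  show ?thesis using assms
  proof (induction F)
    case empty
    then show ?case by (auto simp: ring_mat_simps)
  next
    case (insert x F)
    then have "finsum (ring_mat TYPE('a) n b) g (insert x F)
        = g x + mat n n (\<lambda>(i, j). \<Sum>x\<in>F. g x $$ (i, j))"
      by (subst finsum_insert) (auto simp: ring_mat_simps)
    also have "\<dots> = mat n n (\<lambda>(i, j). \<Sum>x\<in>insert x F. g x $$ (i, j))"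
      using insert by (intro eq_matI) auto
    finally show ?case .
  qed
qed

lemma moment_map_eqs_iff:
  assumes Q: "fin_digraph Q" and R: "R \<in> framed_reps Q d f"
  shows "moment_map_eqs Q d R \<longleftrightarrow>
    (\<forall>v\<in>verts Q. incoming Q d f R v * outgoing Q d f R v = 0\<^sub>m (d v) (d v))"
  unfolding moment_map_eqs_def
proof (intro ball_cong refl)
  fix v assume v: "v \<in> verts Q"
  let ?A = "{e \<in> arcs Q. head Q e = v}" and ?B = "{e \<in> arcs Q. tail Q e = v}"
  have fin: "finite ?A" "finite ?B" using fin_digraph.finite_arcs[OF Q] by auto
  note carr = framed_reps_mem[OF R]
  have A: "mapA R e * mapB R e \<in> carrier_mat (d v) (d v)" if "e \<in> ?A" for e
    using carr(1,2)[of e] that by auto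
  have B: "mapB R e * mapA R e \<in> carrier_mat (d v) (d v)" if "e \<in> ?B" for e
    using carr(1,2)[of e] that by auto
  let ?M = "finsum (ring_mat TYPE(complex) (d v) ()) (\<lambda>e. mapA R e * mapB R e) ?A
        - finsum (ring_mat TYPE(complex) (d v) ()) (\<lambda>e. mapB R e * mapA R e) ?B
        + mapI R v * mapJ R v"
  have IJ: "mapI R v * mapJ R v \<in> carrier_mat (d v) (d v)" using carr(3,4)[OF v] by auto
  have M: "?M \<in> carrier_mat (d v) (d v)" using IJ by auto
  have entry: "?M $$ (i, j) = (\<Sum>h\<in>slots Q v. (inmap R v h * outmap R v h) $$ (i, j))"
    if "i < d v" "j < d v" for i j
  proof -
    have neg: "(mapB R e * - mapA R e) $$ (i, j) = - ((mapB R e * mapA R e) $$ (i, j))" if "e \<in> ?B" for e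
    proof -
      have "mapB R e * - mapA R e = - (mapB R e * mapA R e)"
        using carr(1,2)[of e] that by (intro uminus_mult_right_mat) auto
      moreover have "dim_row (mapB R e * mapA R e) = d v" "dim_col (mapB R e * mapA R e) = d v"
        using B[OF that] by blast+
      ultimately show ?thesis using \<open>i < d v\<close> \<open>j < d v\<close> by (simp del: index_mult_mat)
    qed
    have "(\<Sum>h\<in>slots Q v. (inmap R v h * outmap R v h) $$ (i, j)) =
        (\<Sum>e\<in>?A. (mapA R e * mapB R e) $$ (i, j)) + (\<Sum>e\<in>?B. (mapB R e * - mapA R e) $$ (i, j))
        + (mapI R v * mapJ R v) $$ (i, j)"
      by (subst sum_slots[OF Q]) (simp add: inmap_def outmap_def)
    also have "(\<Sum>e\<in>?B. (mapB R e * - mapA R e) $$ (i, j)) = - (\<Sum>e\<in>?B. (mapB R e * mapA R e) $$ (i, j))"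
      unfolding sum_negf[symmetric] by (rule sum.cong[OF refl neg])
    also have "(\<Sum>e\<in>?A. (mapA R e * mapB R e) $$ (i, j)) + - (\<Sum>e\<in>?B. (mapB R e * mapA R e) $$ (i, j))
        + (mapI R v * mapJ R v) $$ (i, j) = ?M $$ (i, j)"
    proof -
      have "finsum (ring_mat TYPE(complex) (d v) ()) (\<lambda>e. mapA R e * mapB R e) ?A
          = mat (d v) (d v) (\<lambda>(i, j). \<Sum>e\<in>?A. (mapA R e * mapB R e) $$ (i, j))"
        by (rule finsum_ring_mat[OF fin(1) A])
      moreover have "finsum (ring_mat TYPE(complex) (d v) ()) (\<lambda>e. mapB R e * mapA R e) ?B
          = mat (d v) (d v) (\<lambda>(i, j). \<Sum>e\<in>?B. (mapB R e * mapA R e) $$ (i, j))"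
        by (rule finsum_ring_mat[OF fin(2) B])
      moreover have "dim_row (mapI R v * mapJ R v) = d v" "dim_col (mapI R v * mapJ R v) = d v"
        using IJ by blast+
      ultimately show ?thesis using that by (simp del: index_mult_mat)
    qed
    finally show ?thesis by simp
  qed
  have "?M = 0\<^sub>m (d v) (d v) \<longleftrightarrow> (\<forall>i<d v. \<forall>j<d v. ?M $$ (i, j) = 0)"
    by (rule zero_mat_iff[OF M])
  also have "\<dots> \<longleftrightarrow> (\<forall>i<d v. \<forall>j<d v. (\<Sum>h\<in>slots Q v. (inmap R v h * outmap R v h) $$ (i, j)) = 0)"
    using entry by simp
  also have "\<dots> \<longleftrightarrow> incoming Q d f R v * outgoing Q d f R v = 0\<^sub>m (d v) (d v)"
    unfolding incoming_def outgoing_def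
    using inmap_carrier[OF R v] outmap_carrier[OF R v]
    by (intro hcat_vcat_eq_0_iff[OF finite_slots[OF Q], symmetric])
  finally show "?M = 0\<^sub>m (d v) (d v) \<longleftrightarrow> incoming Q d f R v * outgoing Q d f R v = 0\<^sub>m (d v) (d v)" .
qed

lemma stable_iff_slots:
  assumes Q: "wf_digraph Q"
  shows "stable Q d f R \<longleftrightarrow>
    (\<forall>W. (\<forall>v\<in>verts Q. subspace_vec (d v) (W v)) \<longrightarrow>
      (\<forall>v\<in>verts Q. \<forall>h\<in>slots Q v. \<forall>x\<in>slot_space Q f W v h. inmap R v h *\<^sub>v x \<in> W v) \<longrightarrow>
      (\<forall>v\<in>verts Q. W v = carrier_vec (d v)))"
proof -
  have closed: "(\<forall>v\<in>verts Q. \<forall>h\<in>slots Q v. \<forall>x\<in>slot_space Q f W v h. inmap R v h *\<^sub>v x \<in> W v) \<longleftrightarrow>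
      (\<forall>v\<in>verts Q. \<forall>x\<in>carrier_vec (f v). mapI R v *\<^sub>v x \<in> W v) \<and>
      (\<forall>e\<in>arcs Q. \<forall>x\<in>W (tail Q e). mapA R e *\<^sub>v x \<in> W (head Q e)) \<and>
      (\<forall>e\<in>arcs Q. \<forall>x\<in>W (head Q e). mapB R e *\<^sub>v x \<in> W (tail Q e))" for W
    unfolding ball_slots_iff[OF Q] by (auto simp: slot_space_def inmap_def)
  show ?thesis unfolding stable_def closed by (simp only: imp_conjL)
qed

lemma stableD:
  assumes Q: "wf_digraph Q" and stable: "stable Q d f R"
    and sub: "\<And>v. v \<in> verts Q \<Longrightarrow> subspace_vec (d v) (W v)"
    and closed: "\<And>v h x. v \<in> verts Q \<Longrightarrow> h \<in> slots Q v \<Longrightarrow> x \<in> slot_space Q f W v h \<Longrightarrow>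
      inmap R v h *\<^sub>v x \<in> W v"
  shows "\<forall>v\<in>verts Q. W v = carrier_vec (d v)"
proof -
  have "\<forall>v\<in>verts Q. subspace_vec (d v) (W v)" using sub by simp
  moreover have "\<forall>v\<in>verts Q. \<forall>h\<in>slots Q v. \<forall>x\<in>slot_space Q f W v h. inmap R v h *\<^sub>v x \<in> W v"
    using closed by simp
  ultimately show ?thesis using stable[unfolded stable_iff_slots[OF Q], THEN spec, of W] by simp
qed

text \<open>
  Replacing \<open>D v\<close> by the image of \<open>G\<close>, and keeping all other spaces, gives a subrepresentation that contains the
  image of the framing; by stability \<open>G\<close> is onto.
\<close>

lemma stable_right_inverse:
  assumes Q: "wf_digraph Q" and R: "R \<in> framed_reps Q d f" and stable: "stable Q d f R"
    and v: "v \<in> verts Q" and G: "G \<in> carrier_mat (d v) m"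
    and im: "\<And>h x. h \<in> slots Q v \<Longrightarrow> x \<in> carrier_vec (slot_dim Q d f v h) \<Longrightarrow>
      inmap R v h *\<^sub>v x \<in> (\<lambda>y. G *\<^sub>v y) ` carrier_vec m"
  obtains G' where "G' \<in> carrier_mat m (d v)" "G * G' = 1\<^sub>m (d v)"
proof -
  define W where "W u = (if u = v then (\<lambda>y. G *\<^sub>v y) ` carrier_vec m else carrier_vec (d u))" for u
  have sub: "subspace_vec (d u) (W u)" for u
    by (simp add: W_def subspace_vec_carrier subspace_vec_image[OF G subspace_vec_carrier])
  then have carr: "W u \<subseteq> carrier_vec (d u)" for u by (simp add: subspace_vec_iff)
  have "inmap R u h *\<^sub>v x \<in> W u"
    if u: "u \<in> verts Q" and h: "h \<in> slots Q u" and x: "x \<in> slot_space Q f W u h" for u h x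
  proof -
    have x': "x \<in> carrier_vec (slot_dim Q d f u h)"
      using slot_space_subset[where W = W and d = d, OF Q h carr] x by blast
    show ?thesis
    proof (cases "u = v")
      case True
      then show ?thesis using im[of h x] h x' by (simp add: W_def)
    next
      case False
      then show ?thesis
        using mult_mat_vec_carrier[OF inmap_carrier[OF R u h] x'] by (simp add: W_def)
    qed
  qed
  then have "\<forall>u\<in>verts Q. W u = carrier_vec (d u)"
    by (intro stableD[OF Q stable] sub)
  then have "W v = carrier_vec (d v)" using v by blast
  then have "carrier_vec (d v) = (\<lambda>y. G *\<^sub>v y) ` carrier_vec m" by (simp add: W_def)
  then have "\<exists>y\<in>carrier_vec m. G *\<^sub>v y = x" if "x \<in> carrier_vec (d v)" for x
    using that by (auto simp: image_iff)
  then show thesis using surjective_right_inverse[OF G] that by blast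
qed

lemma stable_incoming_right_inverse:
  assumes Q: "fin_digraph Q" and R: "R \<in> framed_reps Q d f" and stable: "stable Q d f R"
    and v: "v \<in> verts Q"
  obtains G' where "G' \<in> carrier_mat (total_slot_dim Q d f v) (d v)"
    "incoming Q d f R v * G' = 1\<^sub>m (d v)"
proof (rule stable_right_inverse[where v = v and G = "incoming Q d f R v",
      OF fin_digraph.axioms(1)[OF Q] R stable v incoming_carrier])
  fix h and x :: "complex vec"
  assume h: "h \<in> slots Q v" and x: "x \<in> carrier_vec (slot_dim Q d f v h)"
  show "inmap R v h *\<^sub>v x \<in> (\<lambda>y. incoming Q d f R v *\<^sub>v y) ` carrier_vec (total_slot_dim Q d f v)"
    unfolding incoming_def total_slot_dim_def
    by (rule hcat_image[where P = "inmap R v" and n = "slot_dim Q d f v",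
          OF finite_slots[OF Q] h inmap_carrier[OF R v h] x])
qed (rule that)

text \<open>
  Each arrow is seen from both of its ends, so the intertwining conditions for the \<open>A\<close> and \<open>B\<close> maps occur among
  the conditions on incoming maps and again among those on outgoing maps.
\<close>

lemma split_parabolic_triples_iff_slots:
  assumes Q: "wf_digraph Q"
  shows "(R0, R1, \<pi>) \<in> split_parabolic_triples Q d0 d1 f \<longleftrightarrow>
    R0 \<in> framed_reps Q d0 f \<and> moment_map_eqs Q d0 R0 \<and> stable Q d0 f R0 \<and>
    R1 \<in> framed_reps Q d1 f \<and> moment_map_eqs Q d1 R1 \<and> stable Q d1 f R1 \<and>
    \<pi> \<in> (\<Pi>\<^sub>E v\<in>verts Q. carrier_mat (d1 v) (d0 v)) \<and>
    (\<forall>v\<in>verts Q. \<forall>h\<in>slots Q v. \<pi> v * inmap R0 v h = inmap R1 v h * slot_map Q f \<pi> v h) \<and>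
    (\<forall>v\<in>verts Q. \<forall>h\<in>slots Q v. slot_map Q f \<pi> v h * outmap R0 v h = outmap R1 v h * \<pi> v) \<and>
    (\<forall>v\<in>verts Q. \<forall>h\<in>slots Q v. \<forall>x\<in>mat_kernel (\<pi> v). outmap R0 v h *\<^sub>v x = 0\<^sub>v (slot_dim Q d0 f v h))"
    (is "?L \<longleftrightarrow> ?R0 \<and> ?m0 \<and> ?s0 \<and> ?R1 \<and> ?m1 \<and> ?s1 \<and> ?\<pi> \<and> ?in \<and> ?out \<and> ?ker")
proof -
  note verts = wf_digraph.head_in_verts[OF Q] wf_digraph.tail_in_verts[OF Q]
  {
    assume R0: ?R0 and R1: ?R1 and \<pi>: ?\<pi>
    note c0 = framed_reps_mem[OF R0] and c1 = framed_reps_mem[OF R1] and c\<pi> = PiE_mem[OF \<pi>]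
    let ?A = "\<forall>e\<in>arcs Q. \<pi> (head Q e) * mapA R0 e = mapA R1 e * \<pi> (tail Q e)"
    let ?B = "\<forall>e\<in>arcs Q. \<pi> (tail Q e) * mapB R0 e = mapB R1 e * \<pi> (head Q e)"
    let ?I = "\<forall>v\<in>verts Q. \<pi> v * mapI R0 v = mapI R1 v"
    let ?J = "\<forall>v\<in>verts Q. mapJ R1 v * \<pi> v = mapJ R0 v"
    let ?kA = "\<forall>e\<in>arcs Q. \<forall>x\<in>mat_kernel (\<pi> (tail Q e)). mapA R0 e *\<^sub>v x = 0\<^sub>v (d0 (head Q e))"
    let ?kB = "\<forall>e\<in>arcs Q. \<forall>x\<in>mat_kernel (\<pi> (head Q e)). mapB R0 e *\<^sub>v x = 0\<^sub>v (d0 (tail Q e))"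
    let ?kJ = "\<forall>v\<in>verts Q. \<forall>x\<in>mat_kernel (\<pi> v). mapJ R0 v *\<^sub>v x = 0\<^sub>v (f v)"
    have I1: "mapI R1 v * 1\<^sub>m (f v) = mapI R1 v" "1\<^sub>m (f v) * mapJ R0 v = mapJ R0 v" if "v \<in> verts Q" for v
      using c1(3)[OF that] c0(4)[OF that] by auto
    have negA: "\<pi> (head Q e) * - mapA R0 e = - mapA R1 e * \<pi> (tail Q e) \<longleftrightarrow>
        \<pi> (head Q e) * mapA R0 e = mapA R1 e * \<pi> (tail Q e)" if "e \<in> arcs Q" for e
    proof -
      have "\<pi> (head Q e) * - mapA R0 e = - (\<pi> (head Q e) * mapA R0 e)"
        "- mapA R1 e * \<pi> (tail Q e) = - (mapA R1 e * \<pi> (tail Q e))"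
        using c0(1)[OF that] c1(1)[OF that] c\<pi>[OF verts(1)[OF that]] c\<pi>[OF verts(2)[OF that]] by auto
      then show ?thesis by (metis uminus_uminus_mat)
    qed
    have negx: "- mapA R0 e *\<^sub>v x = 0\<^sub>v (d0 (head Q e)) \<longleftrightarrow> mapA R0 e *\<^sub>v x = 0\<^sub>v (d0 (head Q e))"
      if "e \<in> arcs Q" "x \<in> mat_kernel (\<pi> (tail Q e))" for e x
    proof -
      have "x \<in> carrier_vec (d0 (tail Q e))"
        using that c\<pi>[OF verts(2)[OF that(1)]] by (auto dest: mat_kernelD)
      then have "- mapA R0 e *\<^sub>v x = - (mapA R0 e *\<^sub>v x)"
        using c0(1)[OF that(1)] by (intro uminus_mult_mat_vec) auto
      then show ?thesis using c0(1)[OF that(1)] by (simp add: vec_eq_iff)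
    qed
    have "?in \<longleftrightarrow> ?A \<and> ?B \<and> ?I"
      unfolding ball_slots_iff[OF Q] by (simp add: inmap_def slot_map_def I1)
    moreover have "?out \<longleftrightarrow> ?A \<and> ?B \<and> ?J"
      unfolding ball_slots_iff[OF Q] by (auto simp: outmap_def slot_map_def I1 negA)
    moreover have "?ker \<longleftrightarrow> ?kA \<and> ?kB \<and> ?kJ"
      unfolding ball_slots_iff[OF Q] by (auto simp: outmap_def slot_dim_def negx)
    ultimately have "?A \<and> ?B \<and> ?I \<and> ?J \<and> ?kA \<and> ?kB \<and> ?kJ \<longleftrightarrow> ?in \<and> ?out \<and> ?ker" by argo
  }
  note conditions = this
  have cong: "(a \<Longrightarrow> d \<Longrightarrow> g \<Longrightarrow> X = Y) \<Longrightarrow>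
      (a \<and> b \<and> c \<and> d \<and> e \<and> f \<and> g \<and> X) = (a \<and> b \<and> c \<and> d \<and> e \<and> f \<and> g \<and> Y)"
    for a b c d e f g X Y by auto
  show ?thesis
    unfolding split_parabolic_triples_def mem_Collect_eq prod.case by (intro cong conditions)
qed

text \<open>
  The images of the projections form a subrepresentation of \<open>R1\<close> containing the image of the framing, so stability of
  \<open>R1\<close> makes the projections onto.
\<close>

lemma split_projection_right_inverse:
  assumes Q: "wf_digraph Q" and T: "(R0, R1, \<pi>) \<in> split_parabolic_triples Q d0 d1 f"
  obtains \<rho> where "\<And>v. v \<in> verts Q \<Longrightarrow> \<rho> v \<in> carrier_mat (d0 v) (d1 v)"
    "\<And>v. v \<in> verts Q \<Longrightarrow> \<pi> v * \<rho> v = 1\<^sub>m (d1 v)"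
proof -
  note T' = T[unfolded split_parabolic_triples_iff_slots[OF Q]]
  have R0: "R0 \<in> framed_reps Q d0 f" and R1: "R1 \<in> framed_reps Q d1 f" and stable: "stable Q d1 f R1"
    using T' by simp_all
  have \<pi>: "\<pi> v \<in> carrier_mat (d1 v) (d0 v)" if "v \<in> verts Q" for v
    using T' PiE_mem[OF _ that] by fast
  have intw: "\<pi> v * inmap R0 v h = inmap R1 v h * slot_map Q f \<pi> v h"
    if "v \<in> verts Q" "h \<in> slots Q v" for v h
    using T' that by simp
  define W where "W v = (\<lambda>x. \<pi> v *\<^sub>v x) ` carrier_vec (d0 v)" for v
  have "\<forall>v\<in>verts Q. W v = carrier_vec (d1 v)"
  proof (rule stableD[OF Q stable])
    fix v assume v: "v \<in> verts Q"
    show "subspace_vec (d1 v) (W v)"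
      unfolding W_def by (rule subspace_vec_image[OF \<pi>[OF v] subspace_vec_carrier])
    fix h x assume h: "h \<in> slots Q v" and "x \<in> slot_space Q f W v h"
    then have "x \<in> (\<lambda>x. slot_map Q f \<pi> v h *\<^sub>v x) ` carrier_vec (slot_dim Q d0 f v h)"
      unfolding W_def slot_space_image slot_space_carrier by simp
    then obtain y where y: "y \<in> carrier_vec (slot_dim Q d0 f v h)" "x = slot_map Q f \<pi> v h *\<^sub>v y"
      by blast
    have "inmap R1 v h *\<^sub>v x = (inmap R1 v h * slot_map Q f \<pi> v h) *\<^sub>v y"
      unfolding y(2) using assoc_mult_mat_vec[OF inmap_carrier[OF R1 v h] slot_map_carrier[OF Q h \<pi>] y(1)]
      by simp
    also have "\<dots> = \<pi> v *\<^sub>v (inmap R0 v h *\<^sub>v y)"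
      unfolding intw[OF v h, symmetric] by (rule assoc_mult_mat_vec[OF \<pi>[OF v] inmap_carrier[OF R0 v h] y(1)])
    finally show "inmap R1 v h *\<^sub>v x \<in> W v"
      unfolding W_def by (rule image_eqI) (rule mult_mat_vec_carrier[OF inmap_carrier[OF R0 v h] y(1)])
  qed
  have "\<forall>v\<in>verts Q. \<exists>M. M \<in> carrier_mat (d0 v) (d1 v) \<and> \<pi> v * M = 1\<^sub>m (d1 v)"
  proof
    fix v assume v: "v \<in> verts Q"
    then have "carrier_vec (d1 v) = (\<lambda>x. \<pi> v *\<^sub>v x) ` carrier_vec (d0 v)"
      using \<open>\<forall>v\<in>verts Q. W v = carrier_vec (d1 v)\<close> by (simp add: W_def)
    then have "\<exists>x\<in>carrier_vec (d0 v). \<pi> v *\<^sub>v x = y" if "y \<in> carrier_vec (d1 v)" for y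
      using that by (auto simp: image_iff)
    then show "\<exists>M. M \<in> carrier_mat (d0 v) (d1 v) \<and> \<pi> v * M = 1\<^sub>m (d1 v)"
      using surjective_right_inverse[OF \<pi>[OF v]] by blast
  qed
  then obtain \<rho> where "\<forall>v\<in>verts Q. \<rho> v \<in> carrier_mat (d0 v) (d1 v) \<and> \<pi> v * \<rho> v = 1\<^sub>m (d1 v)"
    by (rule bchoice[THEN exE])
  then show thesis using that[of \<rho>] by simp
qed

text \<open>
  The map entering \<open>v\<close> through a slot is, up to sign, the map leaving the vertex at the other end of that slot; hence the
  incoming maps vanish on the kernels of the projections at the other ends if the outgoing maps vanish on the kernels of the projections at
  their sources.
\<close>

lemma inmap_absorb:
  assumes Q: "wf_digraph Q" and R: "R \<in> framed_reps Q d f"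
    and \<pi>: "\<And>v. v \<in> verts Q \<Longrightarrow> \<pi> v \<in> carrier_mat (c v) (d v)"
    and \<rho>: "\<And>v. v \<in> verts Q \<Longrightarrow> \<rho> v \<in> carrier_mat (d v) (c v)"
    and out: "\<And>v h. v \<in> verts Q \<Longrightarrow> h \<in> slots Q v \<Longrightarrow> outmap R v h * \<rho> v * \<pi> v = outmap R v h"
    and v: "v \<in> verts Q" and h: "h \<in> slots Q v"
  shows "inmap R v h * slot_map Q f \<rho> v h * slot_map Q f \<pi> v h = inmap R v h"
  using h
proof (cases rule: slotE)
  case (Into e)
  have t: "tail Q e \<in> verts Q" using wf_digraph.tail_in_verts[OF Q Into(2)] .
  have A: "mapA R e \<in> carrier_mat (d (head Q e)) (d (tail Q e))" by (rule framed_reps_mem(1)[OF R Into(2)])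
  have "- mapA R e * \<rho> (tail Q e) * \<pi> (tail Q e) = - mapA R e"
    using out[OF t slotI(2)[OF Into(2)]] by (simp add: outmap_def)
  moreover have "- mapA R e * \<rho> (tail Q e) * \<pi> (tail Q e) = - (mapA R e * \<rho> (tail Q e) * \<pi> (tail Q e))"
    using A \<pi>[OF t] \<rho>[OF t] by simp
  ultimately show ?thesis using Into by (simp add: inmap_def slot_map_def)
next
  case (Outof e)
  have "head Q e \<in> verts Q" using wf_digraph.head_in_verts[OF Q Outof(2)] .
  from out[OF this slotI(1)[OF Outof(2)]] show ?thesis
    using Outof by (simp add: inmap_def outmap_def slot_map_def)
next
  case Frame
  then show ?thesis using framed_reps_mem(3)[OF R v] by (simp add: inmap_def slot_map_def)
qed

section \<open>Rank bounds forced by split parabolic triples\<close>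

text \<open>
  All maps of \<open>R0\<close> vanish on the kernel of \<open>\<pi>\<close>, so the incoming map of \<open>R0\<close> at \<open>v\<close>
  factors through the middle term of the complex of \<open>R1\<close>. The induced map \<open>G\<close> from that middle term to the space
  of \<open>R0\<close> at \<open>v\<close> is onto by stability of \<open>R0\<close>, and it annihilates the outgoing map of
  \<open>R1\<close> by the moment map equation of \<open>R0\<close>. A dimension count finishes the proof.
\<close>

lemma split_lift_rank_bound:
  assumes Q: "fin_digraph Q" and T: "(R0, R1, \<pi>) \<in> split_parabolic_triples Q d0 d1 f"
    and v: "v \<in> verts Q"
  shows "d0 v \<le> total_slot_dim Q d1 f v"
    and "rank_le (total_slot_dim Q d1 f v - d0 v) (outgoing Q d1 f R1 v)"
proof -
  have wf: "wf_digraph Q" using Q by (rule fin_digraph.axioms(1))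
  have fin: "finite (slots Q v)" by (rule finite_slots[OF Q])
  note T' = T[unfolded split_parabolic_triples_iff_slots[OF wf]]
  have R0: "R0 \<in> framed_reps Q d0 f" and R1: "R1 \<in> framed_reps Q d1 f" and stable: "stable Q d0 f R0"
    and mm: "moment_map_eqs Q d0 R0"
    using T' by simp_all
  have \<pi>: "\<pi> v \<in> carrier_mat (d1 v) (d0 v)" if "v \<in> verts Q" for v
    using T' PiE_mem[OF _ that] by fast
  obtain \<rho> where \<rho>: "\<And>v. v \<in> verts Q \<Longrightarrow> \<rho> v \<in> carrier_mat (d0 v) (d1 v)"
    and \<pi>\<rho>: "\<And>v. v \<in> verts Q \<Longrightarrow> \<pi> v * \<rho> v = 1\<^sub>m (d1 v)"
    using split_projection_right_inverse[OF wf T] by blast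
  have out: "slot_map Q f \<pi> v h * outmap R0 v h = outmap R1 v h * \<pi> v" if "h \<in> slots Q v" for h
    using T' v that by simp
  have absorb: "outmap R0 v h * \<rho> v * \<pi> v = outmap R0 v h" if "v \<in> verts Q" "h \<in> slots Q v" for v h
    using T' that
    by (intro kernel_inclusion_factors[OF \<pi> \<rho> \<pi>\<rho> outmap_carrier[OF R0]]) simp_all
  define q r P where "q h = slot_map Q f \<pi> v h" and "r h = slot_map Q f \<rho> v h"
    and "P h = inmap R0 v h * r h" for h
  have q: "q h \<in> carrier_mat (slot_dim Q d1 f v h) (slot_dim Q d0 f v h)" if "h \<in> slots Q v" for h
    unfolding q_def by (rule slot_map_carrier[OF wf that \<pi>])
  have r: "r h \<in> carrier_mat (slot_dim Q d0 f v h) (slot_dim Q d1 f v h)" if "h \<in> slots Q v" for h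
    unfolding r_def by (rule slot_map_carrier[OF wf that \<rho>])
  have P: "P h \<in> carrier_mat (d0 v) (slot_dim Q d1 f v h)" if "h \<in> slots Q v" for h
    unfolding P_def by (rule mult_carrier_mat[OF inmap_carrier[OF R0 v that] r[OF that]])
  have Pq: "P h * q h = inmap R0 v h" if "h \<in> slots Q v" for h
    unfolding P_def q_def r_def by (rule inmap_absorb[OF wf R0 \<pi> \<rho> absorb v that])
  define G where "G = hcat (slots Q v) (slot_dim Q d1 f v) (d0 v) P"
  have G: "G \<in> carrier_mat (d0 v) (total_slot_dim Q d1 f v)"
    unfolding G_def total_slot_dim_def by (rule hcat_carrier)
  obtain G' where G': "G' \<in> carrier_mat (total_slot_dim Q d1 f v) (d0 v)" and GG: "G * G' = 1\<^sub>m (d0 v)"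
  proof (rule stable_right_inverse[OF wf R0 stable v G])
    fix h and x :: "complex vec"
    assume h: "h \<in> slots Q v" and x: "x \<in> carrier_vec (slot_dim Q d0 f v h)"
    have "inmap R0 v h *\<^sub>v x = P h *\<^sub>v (q h *\<^sub>v x)"
      unfolding Pq[OF h, symmetric] by (rule assoc_mult_mat_vec[OF P[OF h] q[OF h] x])
    also have "\<dots> \<in> (\<lambda>y. G *\<^sub>v y) ` carrier_vec (total_slot_dim Q d1 f v)"
      unfolding G_def total_slot_dim_def
      by (rule hcat_image[where P = P and n = "slot_dim Q d1 f v", OF fin h P[OF h] mult_mat_vec_carrier[OF q[OF h] x]])
    finally show "inmap R0 v h *\<^sub>v x \<in> (\<lambda>y. G *\<^sub>v y) ` carrier_vec (total_slot_dim Q d1 f v)" .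
  qed
  \<comment> \<open>After composition with the surjection \<open>\<pi> v\<close> this is the moment map equation of \<open>R0\<close>.\<close>
  have "G * outgoing Q d1 f R1 v = 0\<^sub>m (d0 v) (d1 v)"
  proof (rule cancel_right_inverse[OF _ _ \<pi>[OF v] \<rho>[OF v] \<pi>\<rho>[OF v]])
    show "G * outgoing Q d1 f R1 v \<in> carrier_mat (d0 v) (d1 v)"
      by (rule mult_carrier_mat[OF G outgoing_carrier])
    have "outgoing Q d1 f R1 v * \<pi> v = vcat (slots Q v) (slot_dim Q d1 f v) (d0 v) (\<lambda>h. outmap R1 v h * \<pi> v)"
      unfolding outgoing_def by (rule vcat_mult[OF fin \<pi>[OF v] outmap_carrier[OF R1 v]])
    also have "\<dots> = vcat (slots Q v) (slot_dim Q d1 f v) (d0 v) (\<lambda>h. q h * outmap R0 v h)"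
      by (rule vcat_cong[OF fin]) (simp add: q_def out)
    finally have "G * (outgoing Q d1 f R1 v * \<pi> v)
        = hcat (slots Q v) (slot_dim Q d1 f v) (d0 v) P
          * vcat (slots Q v) (slot_dim Q d1 f v) (d0 v) (\<lambda>h. q h * outmap R0 v h)"
      by (simp add: G_def)
    also have "\<dots> = 0\<^sub>m (d0 v) (d0 v)"
    proof (rule hcat_vcat_zero_transfer[OF fin])
      fix h assume h: "h \<in> slots Q v"
      show "P h \<in> carrier_mat (d0 v) (slot_dim Q d1 f v h)" by (rule P[OF h])
      show "q h * outmap R0 v h \<in> carrier_mat (slot_dim Q d1 f v h) (d0 v)"
        by (rule mult_carrier_mat[OF q[OF h] outmap_carrier[OF R0 v h]])
      show "inmap R0 v h \<in> carrier_mat (d0 v) (slot_dim Q d0 f v h)" by (rule inmap_carrier[OF R0 v h])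
      show "outmap R0 v h \<in> carrier_mat (slot_dim Q d0 f v h) (d0 v)" by (rule outmap_carrier[OF R0 v h])
      show "P h * (q h * outmap R0 v h) = inmap R0 v h * outmap R0 v h"
        unfolding Pq[OF h, symmetric] by (rule assoc_mult_mat[OF P[OF h] q[OF h] outmap_carrier[OF R0 v h], symmetric])
    next
      show "hcat (slots Q v) (slot_dim Q d0 f v) (d0 v) (inmap R0 v)
          * vcat (slots Q v) (slot_dim Q d0 f v) (d0 v) (outmap R0 v) = 0\<^sub>m (d0 v) (d0 v)"
        using mm v unfolding moment_map_eqs_iff[OF Q R0] incoming_def outgoing_def by simp
    qed
    finally have "G * (outgoing Q d1 f R1 v * \<pi> v) = 0\<^sub>m (d0 v) (d0 v)" .
    then show "G * outgoing Q d1 f R1 v * \<pi> v = 0\<^sub>m (d0 v) (d1 v) * \<pi> v"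
      using assoc_mult_mat[OF G outgoing_carrier \<pi>[OF v]] left_mult_zero_mat[OF \<pi>[OF v], of "d0 v"] by simp
  qed simp
  from left_annihilator_imp_rank_le[OF G G' GG outgoing_carrier this]
  show "d0 v \<le> total_slot_dim Q d1 f v"
    and "rank_le (total_slot_dim Q d1 f v - d0 v) (outgoing Q d1 f R1 v)" by blast+
qed

text \<open>
  The outgoing map vanishes on the kernel of \<open>\<pi>\<close>, hence factors through the quotient.
\<close>

lemma split_quotient_rank_bound:
  assumes Q: "fin_digraph Q" and T: "(R0, R1, \<pi>) \<in> split_parabolic_triples Q d0 d1 f"
    and v: "v \<in> verts Q"
  shows "rank_le (d1 v) (outgoing Q d0 f R0 v)"
proof -
  have wf: "wf_digraph Q" using Q by (rule fin_digraph.axioms(1))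
  note T' = T[unfolded split_parabolic_triples_iff_slots[OF wf]]
  have R0: "R0 \<in> framed_reps Q d0 f" using T' by simp
  have \<pi>: "\<pi> v \<in> carrier_mat (d1 v) (d0 v)"
    using T' PiE_mem[OF _ v] by fast
  obtain \<rho> where \<rho>: "\<rho> v \<in> carrier_mat (d0 v) (d1 v)" and \<pi>\<rho>: "\<pi> v * \<rho> v = 1\<^sub>m (d1 v)"
    using split_projection_right_inverse[OF wf T] v by metis
  let ?S = "vcat (slots Q v) (slot_dim Q d0 f v) (d1 v) (\<lambda>h. outmap R0 v h * \<rho> v)"
  have "?S * \<pi> v = vcat (slots Q v) (slot_dim Q d0 f v) (d0 v) (\<lambda>h. outmap R0 v h * \<rho> v * \<pi> v)"
    by (rule vcat_mult[OF finite_slots[OF Q] \<pi> mult_carrier_mat[OF outmap_carrier[OF R0 v] \<rho>]])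
  also have "\<dots> = outgoing Q d0 f R0 v"
    unfolding outgoing_def
  proof (rule vcat_cong[OF finite_slots[OF Q]])
    fix h assume h: "h \<in> slots Q v"
    show "outmap R0 v h * \<rho> v * \<pi> v = outmap R0 v h"
      using T' v h by (intro kernel_inclusion_factors[OF \<pi> \<rho> \<pi>\<rho> outmap_carrier[OF R0 v h]]) simp
  qed
  finally have "outgoing Q d0 f R0 v = ?S * \<pi> v" by simp
  moreover have "?S \<in> carrier_mat (total_slot_dim Q d0 f v) (d1 v)"
    unfolding total_slot_dim_def by (rule vcat_carrier)
  ultimately show ?thesis
    unfolding rank_le_def using \<pi> carrier_matD[OF outgoing_carrier[of Q d0 f R0 v]] by metis
qed

section \<open>Split parabolic triples from rank bounds\<close>

text \<open>
  At each vertex the incoming map of \<open>R\<close> is enlarged to a surjection onto a space of dimension \<open>d v\<close> that still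
  annihilates the outgoing map; its blocks, composed with the projections \<open>\<pi>\<close> at the other ends of the slots, are the maps
  of the lift that enter the vertex. Annihilation of the outgoing map is the moment map equation of the lift. For stability, a
  subrepresentation of the lift containing the framing projects onto \<open>R\<close>, so it contains the images of all blocks.
\<close>

lemma split_lift_exists:
  assumes Q: "fin_digraph Q" and R: "R \<in> framed_reps Q c f"
    and mm: "moment_map_eqs Q c R" and stable: "stable Q c f R"
    and cd: "\<And>v. v \<in> verts Q \<Longrightarrow> c v \<le> d v"
    and dN: "\<And>v. v \<in> verts Q \<Longrightarrow> d v \<le> total_slot_dim Q c f v"
    and rank: "\<And>v. v \<in> verts Q \<Longrightarrow> rank_le (total_slot_dim Q c f v - d v) (outgoing Q c f R v)"
  shows "\<exists>R0 \<pi>. (R0, R, \<pi>) \<in> split_parabolic_triples Q d c f"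
proof -
  have wf: "wf_digraph Q" using Q by (rule fin_digraph.axioms(1))
  note fin = finite_slots[OF Q]
  define \<pi> where "\<pi> = (\<lambda>v\<in>verts Q. mat (c v) (d v) (\<lambda>(i, j). if i = j then 1 else 0) :: complex mat)"
  have \<pi>: "\<pi> v \<in> carrier_mat (c v) (d v)" if "v \<in> verts Q" for v
    using that by (simp add: \<pi>_def)
  let ?H = "\<lambda>v. hcat (slots Q v) (slot_dim Q c f v)"
  have "\<forall>v\<in>verts Q. \<exists>P. (\<forall>h\<in>slots Q v. P h \<in> carrier_mat (d v) (slot_dim Q c f v h)) \<and>
      (\<exists>G'\<in>carrier_mat (total_slot_dim Q c f v) (d v). ?H v (d v) P * G' = 1\<^sub>m (d v)) \<and>
      ?H v (d v) P * outgoing Q c f R v = 0\<^sub>m (d v) (c v) \<and>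
      (\<forall>h\<in>slots Q v. \<pi> v * P h = inmap R v h)" (is "\<forall>v\<in>verts Q. \<exists>P. ?lift v P")
  proof
    fix v assume v: "v \<in> verts Q"
    obtain B' where B': "B' \<in> carrier_mat (total_slot_dim Q c f v) (c v)"
      and BB: "incoming Q c f R v * B' = 1\<^sub>m (c v)"
      using stable_incoming_right_inverse[OF Q R stable v] .
    have BA: "incoming Q c f R v * outgoing Q c f R v = 0\<^sub>m (c v) (c v)"
      using mm v unfolding moment_map_eqs_iff[OF Q R] by simp
    obtain G G' where G: "G \<in> carrier_mat (d v) (total_slot_dim Q c f v)"
      and G': "G' \<in> carrier_mat (total_slot_dim Q c f v) (d v)" and GG: "G * G' = 1\<^sub>m (d v)"
      and GA: "G * outgoing Q c f R v = 0\<^sub>m (d v) (c v)"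
      and ext: "mat (c v) (d v) (\<lambda>(i, j). if i = j then 1 else 0) * G = incoming Q c f R v"
      using extend_left_annihilator[OF incoming_carrier B' BB outgoing_carrier BA rank[OF v] cd[OF v] dN[OF v]] .
    obtain P where P: "\<And>h. h \<in> slots Q v \<Longrightarrow> P h \<in> carrier_mat (d v) (slot_dim Q c f v h)"
      and GP: "G = ?H v (d v) P"
      by (rule hcat_cases[OF fin G[unfolded total_slot_dim_def]]) blast
    have "?H v (c v) (\<lambda>h. \<pi> v * P h) = \<pi> v * G"
      unfolding GP by (rule mult_hcat[OF fin \<pi>[OF v] P, symmetric])
    also have "\<dots> = ?H v (c v) (inmap R v)" using v ext by (simp add: \<pi>_def incoming_def)
    finally have "\<pi> v * P h = inmap R v h" if "h \<in> slots Q v" for h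
      by (rule hcat_inject[where n = "slot_dim Q c f v" and P = "\<lambda>h. \<pi> v * P h" and P' = "inmap R v",
            OF fin _ that mult_carrier_mat[OF \<pi>[OF v] P[OF that]] inmap_carrier[OF R v that]])
    then have "?lift v P" using P G' GG GA GP by auto
    then show "\<exists>P. ?lift v P" by blast
  qed
  then obtain P where lift: "\<forall>v\<in>verts Q. ?lift v (P v)" by (rule bchoice[THEN exE])
  have P: "P v h \<in> carrier_mat (d v) (slot_dim Q c f v h)" if "v \<in> verts Q" "h \<in> slots Q v" for v h
    using lift that by blast
  have \<pi>P: "\<pi> v * P v h = inmap R v h" if "v \<in> verts Q" "h \<in> slots Q v" for v h
    using lift that by blast
  define R0 where "R0 =
    \<lparr> mapA = (\<lambda>e\<in>arcs Q. P (head Q e) (Into e) * \<pi> (tail Q e)),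
      mapB = (\<lambda>e\<in>arcs Q. P (tail Q e) (Outof e) * \<pi> (head Q e)),
      mapI = (\<lambda>v\<in>verts Q. P v Frame),
      mapJ = (\<lambda>v\<in>verts Q. mapJ R v * \<pi> v) \<rparr>"
  \<comment> \<open>The outgoing maps of the lift with the factor \<open>\<pi> v\<close> removed: up to sign, blocks taken at other vertices.\<close>
  define M where "M v h = (case h of Into e \<Rightarrow> P (tail Q e) (Outof e) | Outof e \<Rightarrow> - P (head Q e) (Into e)
      | Frame \<Rightarrow> mapJ R v)" for v h
  have PA: "P (head Q e) (Into e) \<in> carrier_mat (d (head Q e)) (c (tail Q e))"
    and PB: "P (tail Q e) (Outof e) \<in> carrier_mat (d (tail Q e)) (c (head Q e))"
    and \<pi>t: "\<pi> (tail Q e) \<in> carrier_mat (c (tail Q e)) (d (tail Q e))"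
    and \<pi>h: "\<pi> (head Q e) \<in> carrier_mat (c (head Q e)) (d (head Q e))" if e: "e \<in> arcs Q" for e
    using P[OF wf_digraph.head_in_verts[OF wf e] slotI(1)[OF e]] P[OF wf_digraph.tail_in_verts[OF wf e] slotI(2)[OF e]]
      \<pi>[OF wf_digraph.head_in_verts[OF wf e]] \<pi>[OF wf_digraph.tail_in_verts[OF wf e]]
    by (simp_all add: slot_dim_def)
  have PI: "P v Frame \<in> carrier_mat (d v) (f v)" if "v \<in> verts Q" for v
    using P[OF that slotI(3)] by (simp add: slot_dim_def)
  have R0: "R0 \<in> framed_reps Q d f"
    unfolding framed_reps_def R0_def
    using mult_carrier_mat[OF PA \<pi>t] mult_carrier_mat[OF PB \<pi>h] PI
      mult_carrier_mat[OF framed_reps_mem(4)[OF R] \<pi>] by simp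
  have in0: "inmap R0 v h = P v h * slot_map Q f \<pi> v h" if "v \<in> verts Q" "h \<in> slots Q v" for v h
    using that(2) by (cases rule: slotE) (use that(1) PI[OF that(1)] in \<open>simp_all add: R0_def inmap_def slot_map_def\<close>)
  have M: "M v h \<in> carrier_mat (slot_dim Q d f v h) (c v)" if "v \<in> verts Q" "h \<in> slots Q v" for v h
    using that(2)
  proof (cases rule: slotE)
    case (Into e) then show ?thesis using PB[of e] by (simp add: M_def slot_dim_def)
  next
    case (Outof e) then show ?thesis using PA[of e] by (simp add: M_def slot_dim_def)
  next
    case Frame then show ?thesis using framed_reps_mem(4)[OF R that(1)] by (simp add: M_def slot_dim_def)
  qed
  have out0: "outmap R0 v h = M v h * \<pi> v" if "v \<in> verts Q" "h \<in> slots Q v" for v h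
    using that(2)
  proof (cases rule: slotE)
    case (Into e) then show ?thesis by (simp add: R0_def M_def outmap_def)
  next
    case (Outof e) then show ?thesis using PA[of e] \<pi>t[of e] by (simp add: R0_def M_def outmap_def)
  next
    case Frame then show ?thesis using that(1) by (simp add: R0_def M_def outmap_def)
  qed
  have qM: "slot_map Q f \<pi> v h * M v h = outmap R v h" if "v \<in> verts Q" "h \<in> slots Q v" for v h
    using that(2)
  proof (cases rule: slotE)
    case (Into e)
    then show ?thesis
      using \<pi>P[OF wf_digraph.tail_in_verts[OF wf Into(2)] slotI(2)[OF Into(2)]]
      by (simp add: M_def slot_map_def outmap_def inmap_def)
  next
    case (Outof e)
    then show ?thesis
      using \<pi>P[OF wf_digraph.head_in_verts[OF wf Outof(2)] slotI(1)[OF Outof(2)]] PA[of e] \<pi>h[of e]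
      by (simp add: M_def slot_map_def outmap_def inmap_def)
  next
    case Frame
    then show ?thesis using framed_reps_mem(4)[OF R that(1)] by (simp add: M_def slot_map_def outmap_def)
  qed
  have q: "slot_map Q f \<pi> v h \<in> carrier_mat (slot_dim Q c f v h) (slot_dim Q d f v h)"
    if "h \<in> slots Q v" for v h
    by (rule slot_map_carrier[OF wf that \<pi>])
  have intw_out: "slot_map Q f \<pi> v h * outmap R0 v h = outmap R v h * \<pi> v"
    if "v \<in> verts Q" "h \<in> slots Q v" for v h
    unfolding out0[OF that] qM[OF that, symmetric]
    by (rule assoc_mult_mat[OF q[OF that(2)] M[OF that] \<pi>[OF that(1)], symmetric])
  have intw_in: "\<pi> v * inmap R0 v h = inmap R v h * slot_map Q f \<pi> v h"
    if "v \<in> verts Q" "h \<in> slots Q v" for v h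
    unfolding in0[OF that] \<pi>P[OF that, symmetric]
    by (rule assoc_mult_mat[OF \<pi>[OF that(1)] P[OF that] q[OF that(2)], symmetric])
  have ker: "outmap R0 v h *\<^sub>v x = 0\<^sub>v (slot_dim Q d f v h)"
    if "v \<in> verts Q" "h \<in> slots Q v" "x \<in> mat_kernel (\<pi> v)" for v h x
  proof -
    have x: "x \<in> carrier_vec (d v)" "\<pi> v *\<^sub>v x = 0\<^sub>v (c v)"
      using mat_kernelD[OF \<pi>[OF that(1)] that(3)] by auto
    have "outmap R0 v h *\<^sub>v x = M v h *\<^sub>v (\<pi> v *\<^sub>v x)"
      unfolding out0[OF that(1,2)] by (rule assoc_mult_mat_vec[OF M[OF that(1,2)] \<pi>[OF that(1)] x(1)])
    then show ?thesis by (simp add: x(2) mult_mat_zero_vec[OF M[OF that(1,2)]])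
  qed
  have mm0: "moment_map_eqs Q d R0"
    unfolding moment_map_eqs_iff[OF Q R0]
  proof
    fix v assume v: "v \<in> verts Q"
    have GA: "?H v (d v) (P v) * outgoing Q c f R v = 0\<^sub>m (d v) (c v)" using lift v by blast
    show "incoming Q d f R0 v * outgoing Q d f R0 v = 0\<^sub>m (d v) (d v)"
      unfolding incoming_def outgoing_def
    proof (rule hcat_vcat_zero_transfer[OF fin])
      fix h assume h: "h \<in> slots Q v"
      show "inmap R0 v h \<in> carrier_mat (d v) (slot_dim Q d f v h)" by (rule inmap_carrier[OF R0 v h])
      show "outmap R0 v h \<in> carrier_mat (slot_dim Q d f v h) (d v)" by (rule outmap_carrier[OF R0 v h])
      show "P v h \<in> carrier_mat (d v) (slot_dim Q c f v h)" by (rule P[OF v h])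
      show "outmap R v h * \<pi> v \<in> carrier_mat (slot_dim Q c f v h) (d v)"
        by (rule mult_carrier_mat[OF outmap_carrier[OF R v h] \<pi>[OF v]])
      show "inmap R0 v h * outmap R0 v h = P v h * (outmap R v h * \<pi> v)"
        unfolding in0[OF v h] intw_out[OF v h, symmetric]
        by (rule assoc_mult_mat[OF P[OF v h] q[OF h] outmap_carrier[OF R0 v h]])
    next
      have "vcat (slots Q v) (slot_dim Q c f v) (d v) (\<lambda>h. outmap R v h * \<pi> v) = outgoing Q c f R v * \<pi> v"
        unfolding outgoing_def by (rule vcat_mult[OF fin \<pi>[OF v] outmap_carrier[OF R v], symmetric])
      moreover have "?H v (d v) (P v) * (outgoing Q c f R v * \<pi> v)
          = ?H v (d v) (P v) * outgoing Q c f R v * \<pi> v"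
        by (rule assoc_mult_mat[symmetric, OF _ _ \<pi>[OF v]])
          (rule hcat_carrier, rule outgoing_carrier[unfolded total_slot_dim_def])
      ultimately show "?H v (d v) (P v)
          * vcat (slots Q v) (slot_dim Q c f v) (d v) (\<lambda>h. outmap R v h * \<pi> v) = 0\<^sub>m (d v) (d v)"
        using left_mult_zero_mat[OF \<pi>[OF v], of "d v"] by (simp add: GA)
    qed
  qed
  have stable0: "stable Q d f R0"
    unfolding stable_iff_slots[OF wf]
  proof (intro allI impI)
    fix W assume sub: "\<forall>v\<in>verts Q. subspace_vec (d v) (W v)"
      and closed: "\<forall>v\<in>verts Q. \<forall>h\<in>slots Q v. \<forall>x\<in>slot_space Q f W v h. inmap R0 v h *\<^sub>v x \<in> W v"
    have Wc: "slot_space Q f W v h \<subseteq> carrier_vec (slot_dim Q d f v h)" if "h \<in> slots Q v" for v h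
      using sub by (intro slot_space_subset[OF wf that]) (simp add: subspace_vec_iff)
    define W' where "W' v = (\<lambda>x. \<pi> v *\<^sub>v x) ` W v" for v
    have "\<forall>v\<in>verts Q. W' v = carrier_vec (c v)"
    proof (rule stableD[OF wf stable])
      fix v assume v: "v \<in> verts Q"
      show "subspace_vec (c v) (W' v)"
        unfolding W'_def using sub v by (intro subspace_vec_image[OF \<pi>[OF v]]) simp
      fix h x assume h: "h \<in> slots Q v" and "x \<in> slot_space Q f W' v h"
      then obtain y where y: "y \<in> slot_space Q f W v h" "x = slot_map Q f \<pi> v h *\<^sub>v y"
        unfolding W'_def slot_space_image by blast
      have yc: "y \<in> carrier_vec (slot_dim Q d f v h)" using Wc[OF h] y(1) by blast
      have "inmap R v h *\<^sub>v x = (inmap R v h * slot_map Q f \<pi> v h) *\<^sub>v y"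
        unfolding y(2) by (rule assoc_mult_mat_vec[OF inmap_carrier[OF R v h] q[OF h] yc, symmetric])
      also have "\<dots> = \<pi> v *\<^sub>v (inmap R0 v h *\<^sub>v y)"
        unfolding intw_in[OF v h, symmetric]
        by (rule assoc_mult_mat_vec[OF \<pi>[OF v] inmap_carrier[OF R0 v h] yc])
      finally show "inmap R v h *\<^sub>v x \<in> W' v"
        unfolding W'_def by (rule image_eqI) (use closed v h y(1) in simp)
    qed
    then have full: "slot_space Q f W' v h = carrier_vec (slot_dim Q c f v h)" if "h \<in> slots Q v" for v h
      using slot_space_cong[where W = W' and W' = "\<lambda>v. carrier_vec (c v)", OF wf that]
      by (simp add: slot_space_carrier)
    show "\<forall>v\<in>verts Q. W v = carrier_vec (d v)"
    proof
      fix v assume v: "v \<in> verts Q"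
      have PW: "P v h *\<^sub>v x \<in> W v" if h: "h \<in> slots Q v" and x: "x \<in> carrier_vec (slot_dim Q c f v h)" for h x
      proof -
        obtain y where y: "y \<in> slot_space Q f W v h" "x = slot_map Q f \<pi> v h *\<^sub>v y"
          using x unfolding full[OF h, symmetric] W'_def slot_space_image by blast
        have "P v h *\<^sub>v x = inmap R0 v h *\<^sub>v y"
          unfolding y(2) in0[OF v h]
          using Wc[OF h] y(1) by (intro assoc_mult_mat_vec[OF P[OF v h] q[OF h], symmetric]) blast
        then show ?thesis using closed v h y(1) by simp
      qed
      obtain G' where G': "G' \<in> carrier_mat (total_slot_dim Q c f v) (d v)"
        and GG: "?H v (d v) (P v) * G' = 1\<^sub>m (d v)"
        using lift v by blast
      have "x \<in> W v" if x: "x \<in> carrier_vec (d v)" for x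
      proof -
        have "?H v (d v) (P v) *\<^sub>v (G' *\<^sub>v x) \<in> W v"
        proof (rule mult_mat_vec_in_subspace[OF _ hcat_carrier])
          show "subspace_vec (d v) (W v)" using sub v by simp
          show "G' *\<^sub>v x \<in> carrier_vec (\<Sum>h\<in>slots Q v. slot_dim Q c f v h)"
            using mult_mat_vec_carrier[OF G' x] by (simp add: total_slot_dim_def)
          fix s assume "s < (\<Sum>h\<in>slots Q v. slot_dim Q c f v h)"
          then obtain h j where hj: "h \<in> slots Q v" "j < slot_dim Q c f v h"
            "col (?H v (d v) (P v)) s = col (P v h) j"
            using hcat_col[where P = "P v" and n = "slot_dim Q c f v", OF fin _ P[OF v]] by blast
          then show "col (?H v (d v) (P v)) s \<in> W v"
            using PW[OF hj(1), of "unit_vec (slot_dim Q c f v h) j"] mult_mat_unit_vec[OF P[OF v hj(1)] hj(2)]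
            by simp
        qed
        moreover have "?H v (d v) (P v) *\<^sub>v (G' *\<^sub>v x) = x"
          using right_inverse_surjective[OF _ G' GG x] hcat_carrier[of "slots Q v" "slot_dim Q c f v" "d v" "P v"]
          by (simp add: total_slot_dim_def)
        ultimately show ?thesis by simp
      qed
      moreover have "W v \<subseteq> carrier_vec (d v)" using sub v by (simp add: subspace_vec_iff)
      ultimately show "W v = carrier_vec (d v)" by blast
    qed
  qed
  have "\<pi> \<in> (\<Pi>\<^sub>E v\<in>verts Q. carrier_mat (c v) (d v))"
    unfolding \<pi>_def by simp
  then have "(R0, R, \<pi>) \<in> split_parabolic_triples Q d c f"
    unfolding split_parabolic_triples_iff_slots[OF wf]
    using R0 mm0 stable0 R mm stable intw_in intw_out ker by simp
  then show ?thesis by blast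
qed

text \<open>
  A surjection through which the outgoing map at \<open>v\<close> factors has its kernel annihilated by every map leaving \<open>v\<close>.
  The kernels therefore form a subrepresentation, and the quotient by it, written down with sections \<open>\<rho>\<close> of the
  surjections, inherits the moment map equation and stability.
\<close>

lemma split_quotient_exists:
  assumes Q: "fin_digraph Q" and R: "R \<in> framed_reps Q c f"
    and mm: "moment_map_eqs Q c R" and stable: "stable Q c f R"
    and le: "\<And>v. v \<in> verts Q \<Longrightarrow> b v \<le> c v"
    and rank: "\<And>v. v \<in> verts Q \<Longrightarrow> rank_le (b v) (outgoing Q c f R v)"
  shows "\<exists>R1 \<pi>. (R, R1, \<pi>) \<in> split_parabolic_triples Q c b f"
proof -
  have wf: "wf_digraph Q" using Q by (rule fin_digraph.axioms(1))
  note fin = finite_slots[OF Q]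
  have "\<forall>v\<in>verts Q. \<exists>X. fst X \<in> carrier_mat (b v) (c v) \<and> snd X \<in> carrier_mat (c v) (b v) \<and>
      fst X * snd X = 1\<^sub>m (b v) \<and> (\<forall>h\<in>slots Q v. outmap R v h * snd X * fst X = outmap R v h)"
    (is "\<forall>v\<in>verts Q. \<exists>X. ?quot v X")
  proof
    fix v assume v: "v \<in> verts Q"
    obtain S X X' where X: "X \<in> carrier_mat (b v) (c v)" and X': "X' \<in> carrier_mat (c v) (b v)"
      and XX: "X * X' = 1\<^sub>m (b v)" and S: "S \<in> carrier_mat (total_slot_dim Q c f v) (b v)"
      and SX: "outgoing Q c f R v = S * X"
      using rank_le_imp_factors_through_surjection[OF outgoing_carrier rank[OF v] le[OF v]] .
    have "outgoing Q c f R v * X' = S"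
      unfolding SX using assoc_mult_mat[OF S X X'] S by (simp add: XX)
    then have "outgoing Q c f R v * X' * X = outgoing Q c f R v" by (simp add: SX)
    moreover have "outgoing Q c f R v * X' = vcat (slots Q v) (slot_dim Q c f v) (b v) (\<lambda>h. outmap R v h * X')"
      unfolding outgoing_def by (rule vcat_mult[OF fin X' outmap_carrier[OF R v]])
    moreover have "vcat (slots Q v) (slot_dim Q c f v) (b v) (\<lambda>h. outmap R v h * X') * X
        = vcat (slots Q v) (slot_dim Q c f v) (c v) (\<lambda>h. outmap R v h * X' * X)"
      by (rule vcat_mult[OF fin X mult_carrier_mat[OF outmap_carrier[OF R v] X']])
    ultimately have eq: "vcat (slots Q v) (slot_dim Q c f v) (c v) (\<lambda>h. outmap R v h * X' * X)
        = vcat (slots Q v) (slot_dim Q c f v) (c v) (outmap R v)"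
      by (simp add: outgoing_def)
    have "outmap R v h * X' * X = outmap R v h" if "h \<in> slots Q v" for h
      using vcat_inject[where n = "slot_dim Q c f v" and S = "\<lambda>h. outmap R v h * X' * X" and S' = "outmap R v",
          OF fin eq that mult_carrier_mat[OF mult_carrier_mat[OF outmap_carrier[OF R v that] X'] X]
          outmap_carrier[OF R v that]] .
    then have "?quot v (X, X')" using X X' XX by simp
    then show "\<exists>X. ?quot v X" by blast
  qed
  then obtain X where X: "\<forall>v\<in>verts Q. ?quot v (X v)" by (rule bchoice[THEN exE])
  define \<pi> where "\<pi> = (\<lambda>v\<in>verts Q. fst (X v))"
  define \<rho> where "\<rho> = (\<lambda>v. snd (X v))"
  have \<pi>: "\<pi> v \<in> carrier_mat (b v) (c v)" and \<rho>: "\<rho> v \<in> carrier_mat (c v) (b v)"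
    and \<pi>\<rho>: "\<pi> v * \<rho> v = 1\<^sub>m (b v)" if "v \<in> verts Q" for v
    using X that by (simp_all add: \<pi>_def \<rho>_def)
  have absorb: "outmap R v h * \<rho> v * \<pi> v = outmap R v h" if "v \<in> verts Q" "h \<in> slots Q v" for v h
    using X that by (simp add: \<pi>_def \<rho>_def)
  define R1 where "R1 =
    \<lparr> mapA = (\<lambda>e\<in>arcs Q. \<pi> (head Q e) * mapA R e * \<rho> (tail Q e)),
      mapB = (\<lambda>e\<in>arcs Q. \<pi> (tail Q e) * mapB R e * \<rho> (head Q e)),
      mapI = (\<lambda>v\<in>verts Q. \<pi> v * mapI R v),
      mapJ = (\<lambda>v\<in>verts Q. mapJ R v * \<rho> v) \<rparr>"
  have ht: "head Q e \<in> verts Q" "tail Q e \<in> verts Q" if "e \<in> arcs Q" for e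
    using wf_digraph.head_in_verts[OF wf that] wf_digraph.tail_in_verts[OF wf that] .
  have R1: "R1 \<in> framed_reps Q b f"
    unfolding framed_reps_def R1_def
    using mult_carrier_mat[OF mult_carrier_mat[OF \<pi>[OF ht(1)] framed_reps_mem(1)[OF R]] \<rho>[OF ht(2)]]
      mult_carrier_mat[OF mult_carrier_mat[OF \<pi>[OF ht(2)] framed_reps_mem(2)[OF R]] \<rho>[OF ht(1)]]
      mult_carrier_mat[OF \<pi> framed_reps_mem(3)[OF R]] mult_carrier_mat[OF framed_reps_mem(4)[OF R] \<rho>]
    by simp
  have q: "slot_map Q f \<pi> v h \<in> carrier_mat (slot_dim Q b f v h) (slot_dim Q c f v h)"
    and r: "slot_map Q f \<rho> v h \<in> carrier_mat (slot_dim Q c f v h) (slot_dim Q b f v h)"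
    if "h \<in> slots Q v" for v h
    by (rule slot_map_carrier[OF wf that \<pi>], assumption) (rule slot_map_carrier[OF wf that \<rho>])
  have in1: "inmap R1 v h = \<pi> v * (inmap R v h * slot_map Q f \<rho> v h)" if v: "v \<in> verts Q" and h: "h \<in> slots Q v" for v h
  proof -
    have "inmap R1 v h = \<pi> v * inmap R v h * slot_map Q f \<rho> v h"
      using h
    proof (cases rule: slotE)
      case Frame
      then show ?thesis
        using v right_mult_one_mat[OF mult_carrier_mat[OF \<pi>[OF v] framed_reps_mem(3)[OF R v]]]
        by (simp add: R1_def inmap_def slot_map_def)
    qed (auto simp: R1_def inmap_def slot_map_def)
    also have "\<dots> = \<pi> v * (inmap R v h * slot_map Q f \<rho> v h)"
      by (rule assoc_mult_mat[OF \<pi>[OF v] inmap_carrier[OF R v h] r[OF h]])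
    finally show ?thesis .
  qed
  have out1: "outmap R1 v h = slot_map Q f \<pi> v h * outmap R v h * \<rho> v" if v: "v \<in> verts Q" and h: "h \<in> slots Q v" for v h
    using h
  proof (cases rule: slotE)
    case (Into e)
    then show ?thesis by (auto simp: R1_def outmap_def slot_map_def)
  next
    case (Outof e)
    have "\<pi> (head Q e) * - mapA R e = - (\<pi> (head Q e) * mapA R e)"
      using \<pi>[OF ht(1)[OF Outof(2)]] framed_reps_mem(1)[OF R Outof(2)] by simp
    moreover have "- (\<pi> (head Q e) * mapA R e) * \<rho> (tail Q e) = - (\<pi> (head Q e) * mapA R e * \<rho> (tail Q e))"
      using \<pi>[OF ht(1)[OF Outof(2)]] framed_reps_mem(1)[OF R Outof(2)] \<rho>[OF ht(2)[OF Outof(2)]] by simp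
    ultimately show ?thesis using Outof by (auto simp: R1_def outmap_def slot_map_def)
  next
    case Frame
    then show ?thesis
      using v left_mult_one_mat[OF framed_reps_mem(4)[OF R v]]
      by (simp add: R1_def outmap_def slot_map_def)
  qed
  have absorb_in: "inmap R v h * slot_map Q f \<rho> v h * slot_map Q f \<pi> v h = inmap R v h"
    if "v \<in> verts Q" "h \<in> slots Q v" for v h
    by (rule inmap_absorb[OF wf R \<pi> \<rho> absorb that])
  have inr: "inmap R v h * slot_map Q f \<rho> v h \<in> carrier_mat (c v) (slot_dim Q b f v h)"
    if "v \<in> verts Q" "h \<in> slots Q v" for v h
    by (rule mult_carrier_mat[OF inmap_carrier[OF R that] r[OF that(2)]])
  have qout: "slot_map Q f \<pi> v h * outmap R v h \<in> carrier_mat (slot_dim Q b f v h) (c v)"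
    if "v \<in> verts Q" "h \<in> slots Q v" for v h
    by (rule mult_carrier_mat[OF q[OF that(2)] outmap_carrier[OF R that]])
  have intw_in: "\<pi> v * inmap R v h = inmap R1 v h * slot_map Q f \<pi> v h" if "v \<in> verts Q" "h \<in> slots Q v" for v h
    unfolding in1[OF that] assoc_mult_mat[OF \<pi>[OF that(1)] inr[OF that] q[OF that(2)]] absorb_in[OF that] ..
  have intw_out: "slot_map Q f \<pi> v h * outmap R v h = outmap R1 v h * \<pi> v"
    if v: "v \<in> verts Q" and h: "h \<in> slots Q v" for v h
  proof -
    have "outmap R1 v h * \<pi> v = slot_map Q f \<pi> v h * outmap R v h * (\<rho> v * \<pi> v)"
      unfolding out1[OF v h] by (rule assoc_mult_mat[OF qout[OF v h] \<rho>[OF v] \<pi>[OF v]])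
    also have "\<dots> = slot_map Q f \<pi> v h * (outmap R v h * (\<rho> v * \<pi> v))"
      by (rule assoc_mult_mat[OF q[OF h] outmap_carrier[OF R v h] mult_carrier_mat[OF \<rho>[OF v] \<pi>[OF v]]])
    also have "outmap R v h * (\<rho> v * \<pi> v) = outmap R v h"
      using assoc_mult_mat[OF outmap_carrier[OF R v h] \<rho>[OF v] \<pi>[OF v]] absorb[OF v h] by simp
    finally show ?thesis by simp
  qed
  have ker: "outmap R v h *\<^sub>v x = 0\<^sub>v (slot_dim Q c f v h)"
    if v: "v \<in> verts Q" and h: "h \<in> slots Q v" and "x \<in> mat_kernel (\<pi> v)" for v h x
  proof -
    have x: "x \<in> carrier_vec (c v)" "\<pi> v *\<^sub>v x = 0\<^sub>v (b v)"
      using mat_kernelD[OF \<pi>[OF v] that(3)] by auto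
    have S: "outmap R v h * \<rho> v \<in> carrier_mat (slot_dim Q c f v h) (b v)"
      by (rule mult_carrier_mat[OF outmap_carrier[OF R v h] \<rho>[OF v]])
    have "outmap R v h *\<^sub>v x = outmap R v h * \<rho> v *\<^sub>v (\<pi> v *\<^sub>v x)"
      using assoc_mult_mat_vec[OF S \<pi>[OF v] x(1)] absorb[OF v h] by simp
    then show ?thesis by (simp add: x(2) mult_mat_zero_vec[OF S])
  qed
  have mm1: "moment_map_eqs Q b R1"
    unfolding moment_map_eqs_iff[OF Q R1]
  proof
    fix v assume v: "v \<in> verts Q"
    show "incoming Q b f R1 v * outgoing Q b f R1 v = 0\<^sub>m (b v) (b v)"
      unfolding incoming_def outgoing_def
    proof (rule hcat_vcat_zero_transfer[OF fin])
      fix h assume h: "h \<in> slots Q v"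
      show "inmap R1 v h \<in> carrier_mat (b v) (slot_dim Q b f v h)" by (rule inmap_carrier[OF R1 v h])
      show "outmap R1 v h \<in> carrier_mat (slot_dim Q b f v h) (b v)" by (rule outmap_carrier[OF R1 v h])
      show in_c: "\<pi> v * inmap R v h \<in> carrier_mat (b v) (slot_dim Q c f v h)"
        by (rule mult_carrier_mat[OF \<pi>[OF v] inmap_carrier[OF R v h]])
      show out_c: "outmap R v h * \<rho> v \<in> carrier_mat (slot_dim Q c f v h) (b v)"
        by (rule mult_carrier_mat[OF outmap_carrier[OF R v h] \<rho>[OF v]])
      have "outmap R1 v h = slot_map Q f \<pi> v h * (outmap R v h * \<rho> v)"
        unfolding out1[OF v h] by (rule assoc_mult_mat[OF q[OF h] outmap_carrier[OF R v h] \<rho>[OF v]])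
      then have "inmap R1 v h * outmap R1 v h = inmap R1 v h * slot_map Q f \<pi> v h * (outmap R v h * \<rho> v)"
        using assoc_mult_mat[OF inmap_carrier[OF R1 v h] q[OF h] out_c] by simp
      then show "inmap R1 v h * outmap R1 v h = \<pi> v * inmap R v h * (outmap R v h * \<rho> v)"
        by (simp only: intw_in[OF v h])
    next
      have BA: "incoming Q c f R v * outgoing Q c f R v = 0\<^sub>m (c v) (c v)"
        using mm v unfolding moment_map_eqs_iff[OF Q R] by simp
      have "hcat (slots Q v) (slot_dim Q c f v) (b v) (\<lambda>h. \<pi> v * inmap R v h) = \<pi> v * incoming Q c f R v"
        unfolding incoming_def by (rule mult_hcat[OF fin \<pi>[OF v] inmap_carrier[OF R v], symmetric])
      moreover have "vcat (slots Q v) (slot_dim Q c f v) (b v) (\<lambda>h. outmap R v h * \<rho> v) = outgoing Q c f R v * \<rho> v"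
        unfolding outgoing_def by (rule vcat_mult[OF fin \<rho>[OF v] outmap_carrier[OF R v], symmetric])
      moreover have "\<pi> v * incoming Q c f R v * (outgoing Q c f R v * \<rho> v) = 0\<^sub>m (b v) (b v)"
      proof -
        have "\<pi> v * incoming Q c f R v * (outgoing Q c f R v * \<rho> v)
            = \<pi> v * (incoming Q c f R v * (outgoing Q c f R v * \<rho> v))"
          by (rule assoc_mult_mat[OF \<pi>[OF v] incoming_carrier
                mult_carrier_mat[OF outgoing_carrier[of Q c f R v] \<rho>[OF v]]])
        also have "incoming Q c f R v * (outgoing Q c f R v * \<rho> v) = 0\<^sub>m (c v) (b v)"
          using assoc_mult_mat[OF incoming_carrier[of Q c f R v] outgoing_carrier[of Q c f R v] \<rho>[OF v]]
            left_mult_zero_mat[OF \<rho>[OF v], of "c v"] by (simp add: BA)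
        finally show ?thesis using right_mult_zero_mat[OF \<pi>[OF v], of "b v"] by simp
      qed
      ultimately show "hcat (slots Q v) (slot_dim Q c f v) (b v) (\<lambda>h. \<pi> v * inmap R v h)
          * vcat (slots Q v) (slot_dim Q c f v) (b v) (\<lambda>h. outmap R v h * \<rho> v) = 0\<^sub>m (b v) (b v)"
        by simp
    qed
  qed
  have stable1: "stable Q b f R1"
    unfolding stable_iff_slots[OF wf]
  proof (intro allI impI)
    fix W assume sub: "\<forall>v\<in>verts Q. subspace_vec (b v) (W v)"
      and closed: "\<forall>v\<in>verts Q. \<forall>h\<in>slots Q v. \<forall>x\<in>slot_space Q f W v h. inmap R1 v h *\<^sub>v x \<in> W v"
    define W' where "W' v = {x \<in> carrier_vec (c v). \<pi> v *\<^sub>v x \<in> W v}" for v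
    have "\<forall>v\<in>verts Q. W' v = carrier_vec (c v)"
    proof (rule stableD[OF wf stable])
      fix v assume v: "v \<in> verts Q"
      show "subspace_vec (c v) (W' v)"
        unfolding W'_def using sub v by (intro subspace_vec_vimage[OF \<pi>[OF v]]) simp
      fix h x assume h: "h \<in> slots Q v" and x: "x \<in> slot_space Q f W' v h"
      have xc: "x \<in> carrier_vec (slot_dim Q c f v h)"
        using slot_space_subset[where W = W' and d = c, OF wf h] x by (auto simp: W'_def)
      have qx: "slot_map Q f \<pi> v h *\<^sub>v x \<in> slot_space Q f W v h"
        using x by (cases h) (auto simp: slot_space_def slot_map_def W'_def)
      have "\<pi> v *\<^sub>v (inmap R v h *\<^sub>v x) = (\<pi> v * inmap R v h) *\<^sub>v x"
        by (rule assoc_mult_mat_vec[OF \<pi>[OF v] inmap_carrier[OF R v h] xc, symmetric])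
      also have "\<dots> = inmap R1 v h *\<^sub>v (slot_map Q f \<pi> v h *\<^sub>v x)"
        unfolding intw_in[OF v h] by (rule assoc_mult_mat_vec[OF inmap_carrier[OF R1 v h] q[OF h] xc])
      also have "\<dots> \<in> W v" using closed v h qx by simp
      finally show "inmap R v h *\<^sub>v x \<in> W' v"
        unfolding W'_def using mult_mat_vec_carrier[OF inmap_carrier[OF R v h] xc] by simp
    qed
    show "\<forall>v\<in>verts Q. W v = carrier_vec (b v)"
    proof
      fix v assume v: "v \<in> verts Q"
      have "y \<in> W v" if y: "y \<in> carrier_vec (b v)" for y
      proof -
        have "\<rho> v *\<^sub>v y \<in> W' v"
          using \<open>\<forall>v\<in>verts Q. W' v = carrier_vec (c v)\<close> v mult_mat_vec_carrier[OF \<rho>[OF v] y] by simp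
        then have "\<pi> v *\<^sub>v (\<rho> v *\<^sub>v y) \<in> W v" by (simp add: W'_def)
        then show ?thesis using right_inverse_surjective[OF \<pi>[OF v] \<rho>[OF v] \<pi>\<rho>[OF v] y] by simp
      qed
      moreover have "W v \<subseteq> carrier_vec (b v)" using sub v by (simp add: subspace_vec_iff)
      ultimately show "W v = carrier_vec (b v)" by blast
    qed
  qed
  have "\<pi> \<in> (\<Pi>\<^sub>E v\<in>verts Q. carrier_mat (b v) (c v))"
    using \<pi> by (auto simp: \<pi>_def)
  then have "(R, R1, \<pi>) \<in> split_parabolic_triples Q c b f"
    unfolding split_parabolic_triples_iff_slots[OF wf]
    using R mm stable R1 mm1 stable1 intw_in intw_out ker by simp
  then show ?thesis by blast
qed

section \<open>Nonemptiness\<close>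

lemma split_parabolic_quiver_variety_nonempty_iff:
  "split_parabolic_quiver_variety Q d0 d1 f \<noteq> {} \<longleftrightarrow>
    (\<forall>v\<in>verts Q. 0 \<le> d0 v \<and> 0 \<le> d1 v) \<and>
    split_parabolic_triples Q (\<lambda>v. nat (d0 v)) (\<lambda>v. nat (d1 v)) f \<noteq> {}"
  by (auto simp: split_parabolic_quiver_variety_def Let_def orbits_def)

theorem corollary3p18:
  fixes Q :: "('v, 'e) pre_digraph" and d f k :: "'v \<Rightarrow> nat"
  assumes "fin_digraph Q"
    and "\<forall>v\<in>verts Q. k v \<le> d v"
    and "\<exists>v\<in>verts Q. k v \<noteq> 0"
  shows "split_parabolic_quiver_variety Q
             (\<lambda>v. int (d v)) (\<lambda>v. int (d v) - int (k v)) f \<noteq> {} \<longleftrightarrow>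
         split_parabolic_quiver_variety Q
             (\<lambda>v. int (d v) - int (k v))
             (\<lambda>v. int (d v) - int (k v)
                  - max (int (k v) + k0 Q f (\<lambda>w. int (d w) - int (k w)) v) 0) f \<noteq> {}"
proof -
  note Q = assms(1)
  have wf: "wf_digraph Q" using Q by (rule fin_digraph.axioms(1))
  define c where "c v = d v - k v" for v
  define N where "N = total_slot_dim Q c f"
  define b where "b v = int (d v) - int (k v) - max (int (k v) + k0 Q f (\<lambda>w. int (d w) - int (k w)) v) 0" for v
  have cd: "c v \<le> d v" for v by (simp add: c_def)
  have "k0 Q f (\<lambda>w. int (d w) - int (k w)) v = 2 * int (c v) - int (N v)" if "v \<in> verts Q" for v
    unfolding N_def using assms(2) that by (intro k0_eq_total_slot_dim[OF Q]) (auto simp: c_def of_nat_diff)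
  \<comment> \<open>The maximum turns into the minimum of the two bounds on the rank of the outgoing map.\<close>
  then have b: "b v = min (int (c v)) (int (N v) - int (d v))" if "v \<in> verts Q" for v
    using assms(2) that by (auto simp: b_def c_def of_nat_diff)
  have natc: "(\<lambda>v. nat (int (d v) - int (k v))) = c" by (auto simp: c_def nat_diff_distrib')
  have lift: "split_parabolic_quiver_variety Q (\<lambda>v. int (d v)) (\<lambda>v. int (d v) - int (k v)) f \<noteq> {} \<longleftrightarrow>
      split_parabolic_triples Q d c f \<noteq> {}"
    using assms(2) by (simp add: split_parabolic_quiver_variety_nonempty_iff natc)
  have quot: "split_parabolic_quiver_variety Q (\<lambda>v. int (d v) - int (k v)) b f \<noteq> {} \<longleftrightarrow>
      (\<forall>v\<in>verts Q. 0 \<le> b v) \<and> split_parabolic_triples Q c (\<lambda>v. nat (b v)) f \<noteq> {}"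
    using assms(2) by (auto simp: split_parabolic_quiver_variety_nonempty_iff natc)
  have "split_parabolic_triples Q d c f \<noteq> {} \<longleftrightarrow>
      (\<forall>v\<in>verts Q. 0 \<le> b v) \<and> split_parabolic_triples Q c (\<lambda>v. nat (b v)) f \<noteq> {}"
  proof
    assume "split_parabolic_triples Q d c f \<noteq> {}"
    then obtain R0 R \<pi> where T: "(R0, R, \<pi>) \<in> split_parabolic_triples Q d c f" by auto
    then have R: "R \<in> framed_reps Q c f" "moment_map_eqs Q c R" "stable Q c f R"
      by (simp_all add: split_parabolic_triples_iff_slots[OF wf])
    have dN: "d v \<le> N v" and rank: "rank_le (N v - d v) (outgoing Q c f R v)" if "v \<in> verts Q" for v
      unfolding N_def using split_lift_rank_bound[OF Q T that] by auto
    have "nat (b v) \<le> c v" if "v \<in> verts Q" for v using b[OF that] by simp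
    moreover have "rank_le (nat (b v)) (outgoing Q c f R v)" if v: "v \<in> verts Q" for v
    proof (cases "c v \<le> N v - d v")
      case True
      then have "nat (b v) = c v" using b[OF v] dN[OF v] by simp
      then show ?thesis using rank_le_ncols[OF outgoing_carrier[of Q c f R v]] by simp
    next
      case False
      then have "nat (b v) = N v - d v" using b[OF v] dN[OF v] by simp
      then show ?thesis using rank[OF v] by simp
    qed
    ultimately have "\<exists>R1 \<pi>. (R, R1, \<pi>) \<in> split_parabolic_triples Q c (\<lambda>v. nat (b v)) f"
      by (rule split_quotient_exists[OF Q R])
    moreover have "\<forall>v\<in>verts Q. 0 \<le> b v" using b dN by simp
    ultimately show "(\<forall>v\<in>verts Q. 0 \<le> b v) \<and> split_parabolic_triples Q c (\<lambda>v. nat (b v)) f \<noteq> {}"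
      by blast
  next
    assume *: "(\<forall>v\<in>verts Q. 0 \<le> b v) \<and> split_parabolic_triples Q c (\<lambda>v. nat (b v)) f \<noteq> {}"
    then obtain R R1 \<pi> where T: "(R, R1, \<pi>) \<in> split_parabolic_triples Q c (\<lambda>v. nat (b v)) f" by auto
    then have R: "R \<in> framed_reps Q c f" "moment_map_eqs Q c R" "stable Q c f R"
      by (simp_all add: split_parabolic_triples_iff_slots[OF wf])
    have dN: "d v \<le> N v" if "v \<in> verts Q" for v using * b[OF that] that by fastforce
    have "rank_le (N v - d v) (outgoing Q c f R v)" if v: "v \<in> verts Q" for v
    proof (rule rank_le_mono[OF split_quotient_rank_bound[OF Q T v]])
      show "nat (b v) \<le> N v - d v" using b[OF v] dN[OF v] by simp
    qed
    from split_lift_exists[OF Q R cd dN[unfolded N_def] this[unfolded N_def]]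
    show "split_parabolic_triples Q d c f \<noteq> {}" by blast
  qed
  then show ?thesis using lift quot unfolding b_def by simp
qed

end
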